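(* Let $R$ be a commutative unital ring with the discrete topology and let $(\Lambda,\lesssim)$ be a $\mathbb{Z}$-like preordered set. Then there is a unique group topology on $\mathrm{AU}_{\Lambda}(R)$ such that the inclusion of $\mathrm{U}_{\Lambda+\Lambda'}(R)$ into $\mathrm{AU}_{\Lambda}(R)$ is continuous and open for every finite convex subset $\Lambda'$ of $\Lambda$. If $R$ is finite, then with this topology $\mathrm{AU}_{\Lambda}(R)$ is locally profinite, that is, it is a totally disconnected, locally compact group.
   Context: Let $(\Lambda,\lesssim)$ be a preordered set ($\lesssim$ reflexive and transitive). Write $i\sim j$ if $i\lesssim j$ and $j\lesssim i$; $i\lnsim j$ if $i\lesssim j$ and $i\not\sim j$; $[i,j]=\{k\in\Lambda : i\lesssim k\lesssim j\}$. A subset $\Lambda'\subseteq\Lambda$ is convex if $[i,j]\subseteq\Lambda'$ whenever $i,j\in\Lambda'$; it is strongly convex if for every $i\in\Lambda\setminus\Lambda'$ either $i\lnsim j$ for all $j\in\Lambda'$, or $j\lnsim i$ for all $j\in\Lambda'$. $(\Lambda,\lesssim)$ is $\mathbb{Z}$-like if every finite subset of $\Lambda$ is contained in a finite strongly convex subset. A $(\Lambda\times\Lambda)$-matrix over $R$ is a tuple $(a_{ij})_{i,j\in\Lambda}$ of elements of $R$; $\mathrm{M}_\Lambda(R)$ is the set of these. The product of $(a_{ij})$ and $(b_{ij})$ is $(\sum_{k}a_{ik}b_{kj})_{i,j}$, defined only when each of these sums has finitely many nonzero terms. The matrix $(a_{ij})$ is nonsingular if there is a finite convex $\Lambda'\subseteq\Lambda$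 such that $(a_{ij})_{i,j\in\Lambda''}$ is invertible over $R$ for every finite convex $\Lambda''\supseteq\Lambda'$; upper triangular if $a_{ij}=0$ whenever $i\not\lesssim j$; almost upper triangular if $a_{ij}=0$ for all but finitely many pairs $(i,j)$ with $i\not\lesssim j$. $\mathrm{U}_\Lambda(R)$ and $\mathrm{AU}_\Lambda(R)$ are the groups (under matrix multiplication) of nonsingular upper triangular and nonsingular almost upper triangular matrices, respectively. For a finite convex $\Lambda'\subseteq\Lambda$, $\Lambda+\Lambda'$ denotes the set $\Lambda$ with the smallest preorder containing $\lesssim$ and making all elements of $\Lambda'$ equivalent (it is again $\mathbb{Z}$-like). $\mathrm{AU}_\Lambda(R)$ is the union of its subgroups $\mathrm{U}_{\Lambda+\Lambda'}(R)$. For any $\mathbb{Z}$-like preorder on $\Lambda$, the group $\mathrm{U}_\Lambda(R)$ carries the subspace topology from the product topology on $\mathrm{M}_\Lambda(R)=R^{\Lambda\times\Lambda}$. *)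

theory Defs
  imports "HOL-Analysis.Analysis" "HOL-Algebra.Ring"
begin

section \<open>Preordered sets\<close>

text \<open>
  A preordered set is a carrier \<open>L\<close> together with a relation \<open>r\<close> such that
  \<^term>\<open>preorder_on L r\<close>; \<open>(i, j) \<in> r\<close> means \<open>i \<lesssim> j\<close>.
\<close>

definition preorder_less :: "('i \<times> 'i) set \<Rightarrow> 'i \<Rightarrow> 'i \<Rightarrow> bool" where
  "preorder_less r i j \<longleftrightarrow> (i, j) \<in> r \<and> \<not> ((i, j) \<in> r \<and> (j, i) \<in> r)"

definition preorder_interval :: "'i set \<Rightarrow> ('i \<times> 'i) set \<Rightarrow> 'i \<Rightarrow> 'i \<Rightarrow> 'i set" where
  "preorder_interval L r i j = {k \<in> L. (i, k) \<in> r \<and> (k, j) \<in> r}"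

definition preorder_convex :: "'i set \<Rightarrow> ('i \<times> 'i) set \<Rightarrow> 'i set \<Rightarrow> bool" where
  "preorder_convex L r C \<longleftrightarrow>
     C \<subseteq> L \<and> (\<forall>i\<in>C. \<forall>j\<in>C. preorder_interval L r i j \<subseteq> C)"

definition strongly_convex :: "'i set \<Rightarrow> ('i \<times> 'i) set \<Rightarrow> 'i set \<Rightarrow> bool" where
  "strongly_convex L r C \<longleftrightarrow>
     C \<subseteq> L \<and> (\<forall>i\<in>L - C. (\<forall>j\<in>C. preorder_less r i j) \<or> (\<forall>j\<in>C. preorder_less r j i))"

definition Z_like :: "'i set \<Rightarrow> ('i \<times> 'i) set \<Rightarrow> bool" where
  "Z_like L r \<longleftrightarrow>
     (\<forall>F. finite F \<and> F \<subseteq> L \<longrightarrow> (\<exists>C. finite C \<and> strongly_convex L r C \<and> F \<subseteq> C))"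

text \<open>The preorder of \<open>\<Lambda> + \<Lambda>'\<close>; the family intersected contains \<^term>\<open>L \<times> L\<close>.\<close>

definition preorder_adjoin :: "'i set \<Rightarrow> ('i \<times> 'i) set \<Rightarrow> 'i set \<Rightarrow> ('i \<times> 'i) set" where
  "preorder_adjoin L r C = \<Inter> {s. preorder_on L s \<and> r \<subseteq> s \<and> C \<times> C \<subseteq> s}"


section \<open>Matrices\<close>

text \<open>
  \<open>M\<^sub>\<Lambda>(R)\<close> is \<^term>\<open>L \<times> L \<rightarrow>\<^sub>E carrier R\<close>. The product is a total operation here:
  an entry is the sum of the nonzero terms, and has the junk value \<open>\<zero>\<close> if there
  are infinitely many of them. This never happens in the groups below, since a
  product of almost upper triangular matrices over a \<open>\<int>\<close>-like preordered set has
  only finite sums. The structure \<open>mat_struct R C\<close> is a monoid for finite \<open>C\<close>.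
\<close>

definition mat_mult ::
    "('r, 'm) ring_scheme \<Rightarrow> 'i set \<Rightarrow> ('i \<times> 'i \<Rightarrow> 'r) \<Rightarrow> ('i \<times> 'i \<Rightarrow> 'r) \<Rightarrow> 'i \<times> 'i \<Rightarrow> 'r" where
  "mat_mult R L A B =
     (\<lambda>(i, j) \<in> L \<times> L.
        finsum R (\<lambda>k. A (i, k) \<otimes>\<^bsub>R\<^esub> B (k, j)) {k \<in> L. A (i, k) \<otimes>\<^bsub>R\<^esub> B (k, j) \<noteq> \<zero>\<^bsub>R\<^esub>})"

definition mat_one :: "('r, 'm) ring_scheme \<Rightarrow> 'i set \<Rightarrow> 'i \<times> 'i \<Rightarrow> 'r" where
  "mat_one R L = (\<lambda>(i, j) \<in> L \<times> L. if i = j then \<one>\<^bsub>R\<^esub> else \<zero>\<^bsub>R\<^esub>)"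

definition mat_struct :: "('r, 'm) ring_scheme \<Rightarrow> 'i set \<Rightarrow> ('i \<times> 'i \<Rightarrow> 'r) monoid" where
  "mat_struct R L =
     \<lparr>carrier = L \<times> L \<rightarrow>\<^sub>E carrier R, monoid.mult = mat_mult R L, one = mat_one R L\<rparr>"

definition nonsingular_mat ::
    "('r, 'm) ring_scheme \<Rightarrow> 'i set \<Rightarrow> ('i \<times> 'i) set \<Rightarrow> ('i \<times> 'i \<Rightarrow> 'r) \<Rightarrow> bool" where
  "nonsingular_mat R L r A \<longleftrightarrow>
     (\<exists>C. finite C \<and> preorder_convex L r C \<and>
        (\<forall>D. finite D \<and> preorder_convex L r D \<and> C \<subseteq> D \<longrightarrow>
           restrict A (D \<times> D) \<in> Units (mat_struct R D)))"

definition upper_triangular_mat ::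
    "('r, 'm) ring_scheme \<Rightarrow> 'i set \<Rightarrow> ('i \<times> 'i) set \<Rightarrow> ('i \<times> 'i \<Rightarrow> 'r) \<Rightarrow> bool" where
  "upper_triangular_mat R L r A \<longleftrightarrow> (\<forall>i\<in>L. \<forall>j\<in>L. (i, j) \<notin> r \<longrightarrow> A (i, j) = \<zero>\<^bsub>R\<^esub>)"

definition almost_upper_triangular_mat ::
    "('r, 'm) ring_scheme \<Rightarrow> 'i set \<Rightarrow> ('i \<times> 'i) set \<Rightarrow> ('i \<times> 'i \<Rightarrow> 'r) \<Rightarrow> bool" where
  "almost_upper_triangular_mat R L r A \<longleftrightarrow>
     finite {(i, j). i \<in> L \<and> j \<in> L \<and> (i, j) \<notin> r \<and> A (i, j) \<noteq> \<zero>\<^bsub>R\<^esub>}"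

definition U_set ::
    "('r, 'm) ring_scheme \<Rightarrow> 'i set \<Rightarrow> ('i \<times> 'i) set \<Rightarrow> ('i \<times> 'i \<Rightarrow> 'r) set" where
  "U_set R L r =
     {A \<in> L \<times> L \<rightarrow>\<^sub>E carrier R. nonsingular_mat R L r A \<and> upper_triangular_mat R L r A}"

definition AU_set ::
    "('r, 'm) ring_scheme \<Rightarrow> 'i set \<Rightarrow> ('i \<times> 'i) set \<Rightarrow> ('i \<times> 'i \<Rightarrow> 'r) set" where
  "AU_set R L r =
     {A \<in> L \<times> L \<rightarrow>\<^sub>E carrier R. nonsingular_mat R L r A \<and> almost_upper_triangular_mat R L r A}"

definition AU_group ::
    "('r, 'm) ring_scheme \<Rightarrow> 'i set \<Rightarrow> ('i \<times> 'i) set \<Rightarrow> ('i \<times> 'i \<Rightarrow> 'r) monoid" where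
  "AU_group R L r = (mat_struct R L)\<lparr>carrier := AU_set R L r\<rparr>"


section \<open>Topologies\<close>

definition mat_topology :: "('r, 'm) ring_scheme \<Rightarrow> 'i set \<Rightarrow> ('i \<times> 'i \<Rightarrow> 'r) topology" where
  "mat_topology R L = product_topology (\<lambda>_. discrete_topology (carrier R)) (L \<times> L)"

definition U_topology ::
    "('r, 'm) ring_scheme \<Rightarrow> 'i set \<Rightarrow> ('i \<times> 'i) set \<Rightarrow> ('i \<times> 'i \<Rightarrow> 'r) topology" where
  "U_topology R L r = subtopology (mat_topology R L) (U_set R L r)"

definition group_topology :: "('a, 'm) monoid_scheme \<Rightarrow> 'a topology \<Rightarrow> bool" where
  "group_topology G T \<longleftrightarrow>
     group G \<and> topspace T = carrier G \<and>
     continuous_map (prod_topology T T) T (\<lambda>(x, y). x \<otimes>\<^bsub>G\<^esub> y) \<and>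
     continuous_map T T (\<lambda>x. inv\<^bsub>G\<^esub> x)"

definition totally_disconnected_space :: "'a topology \<Rightarrow> bool" where
  "totally_disconnected_space T \<longleftrightarrow> (\<forall>x\<in>topspace T. connected_component_of_set T x = {x})"

definition locally_profinite :: "('a, 'm) monoid_scheme \<Rightarrow> 'a topology \<Rightarrow> bool" where
  "locally_profinite G T \<longleftrightarrow>
     group_topology G T \<and> totally_disconnected_space T \<and> locally_compact_space T"

definition AU_topology ::
    "('r, 'm) ring_scheme \<Rightarrow> 'i set \<Rightarrow> ('i \<times> 'i) set \<Rightarrow> ('i \<times> 'i \<Rightarrow> 'r) topology \<Rightarrow> bool" where
  "AU_topology R L r T \<longleftrightarrow>
     group_topology (AU_group R L r) T \<and>
     (\<forall>C. finite C \<and> preorder_convex L r C \<longrightarrow>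
        continuous_map (U_topology R L (preorder_adjoin L r C)) T (\<lambda>A. A) \<and>
        open_map (U_topology R L (preorder_adjoin L r C)) T (\<lambda>A. A))"

end

(*
  On the triangular matrices over a locally finite preorder multiplication only involves finite
  sums, and they form a ring.  The nonsingular ones are exactly its units: the inverses of the
  finite convex blocks are compatible because the inverse of an invertible triangular block is
  again triangular.  The latter is Dedekind finiteness of matrix rings over a commutative ring in
  disguise, and follows from Nakayama's lemma, which makes the inverse of a matrix A a matrix in a
  commutative ring of triangular matrices containing A.

  Strong convexity makes the preorder of L + C a finite extension of the given one.  Hence the
  groups of L + C, which are directed with union AU, are open in one another, and the final
  topology on AU is the only candidate.  It is a group topology since each entry of a product or of
  an inverse depends on finitely many entries of the factors.  For finite R every U is closed in a
  product of finite discrete spaces, hence a compact open subgroup of AU.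
*)

theory Submission
  imports Defs "HOL-Algebra.Subrings"
begin

section \<open>Right inverses in commutative subrings\<close>

text \<open>The inverse of a block comes from the full matrix ring, with no control over its shape.
  Equivalence classes may have several elements, and back substitution would need invertible
  diagonal blocks, which is itself the finiteness statement to be proved. Triangularity matters
  because restriction to a convex block is multiplicative on triangular matrices but not on
  arbitrary ones, so inverses of nested blocks could not be compared otherwise. In Nakayama's lemma
  the module is the full ring of a finite block: \<open>A B = 1\<close> makes multiplication by
  \<open>A\<close> surjective on it.

  Nonsingularity speaks only of large blocks, a condition that looks neither closed nor independent
  of the preorder. The first difficulty disappears with the identification as units: every finite
  convex block of a unit is invertible, so one singular block excludes a whole neighbourhood. The
  second disappears because the convex sets containing \<open>C\<close> are the same for L and L +
  C. Hence inside the group of a larger set, membership in the group of \<open>C\<close> is just the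
  vanishing of finitely many entries.\<close>

lemma (in abelian_monoid) finsum_swap:
  assumes "\<And>a b. a \<in> A \<Longrightarrow> b \<in> B \<Longrightarrow> f a b \<in> carrier G"
  shows "(\<Oplus>a\<in>A. \<Oplus>b\<in>B. f a b) = (\<Oplus>b\<in>B. \<Oplus>a\<in>A. f a b)"
  using assms
proof (induction A rule: infinite_finite_induct)
  case (insert x A)
  have "(\<Oplus>a\<in>insert x A. \<Oplus>b\<in>B. f a b) = (\<Oplus>b\<in>B. f x b) \<oplus> (\<Oplus>b\<in>B. \<Oplus>a\<in>A. f a b)"
    using insert by (subst finsum_insert) (auto intro!: finsum_closed)
  also have "\<dots> = (\<Oplus>b\<in>B. f x b \<oplus> (\<Oplus>a\<in>A. f a b))"
    using insert by (intro finsum_addf[symmetric]) (auto intro!: finsum_closed)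
  also have "\<dots> = (\<Oplus>b\<in>B. \<Oplus>a\<in>insert x A. f a b)"
    using insert by (intro finsum_cong') (auto intro!: finsum_closed)
  finally show ?case .
qed (auto simp: finsum_zero finsum_infinite)

text \<open>
  Nakayama's lemma for \<open>R\<close> as a module over \<open>P\<close>, without determinants: the generators are
  removed one at a time from the span containing all \<open>u \<otimes> x\<close>, where \<open>u = \<one> \<ominus> a \<otimes> p\<close>.
\<close>

lemma (in ring) right_inverse_in_subcring:
  assumes P: "subcring P R" and S: "finite S" "e \<in> S \<rightarrow> carrier R"
    and gen: "\<And>x. x \<in> carrier R \<Longrightarrow> \<exists>g\<in>S \<rightarrow> P. x = (\<Oplus>s\<in>S. g s \<otimes> e s)"
    and a: "a \<in> P" and b: "b \<in> carrier R" and ab: "a \<otimes> b = \<one>"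
  shows "\<exists>p\<in>P. a \<otimes> p = \<one>"
proof -
  interpret P: subcring P R by fact
  note sub = subringE[OF P.subring_axioms]
  have PR [simp]: "x \<in> carrier R" if "x \<in> P" for x using sub(1) that by auto
  have S' [simp]: "e s \<in> carrier R" if "s \<in> S" for s using S(2) that by auto
  have minusP: "x \<ominus> y \<in> P" if "x \<in> P" "y \<in> P" for x y
    using that sub(5,7) by (simp add: a_minus_def)
  note Pcl = sub(3,6,7) minusP
  have aR [simp]: "a \<in> carrier R" using a by simp
  have "\<exists>p\<in>P. \<forall>x\<in>carrier R. \<exists>g\<in>(S - U) \<rightarrow> P. (\<one> \<ominus> a \<otimes> p) \<otimes> x = (\<Oplus>s\<in>S - U. g s \<otimes> e s)"
    if "finite U" "U \<subseteq> S" for U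
    using that
  proof (induction U rule: finite_induct)
    case empty
    show ?case
      using sub(2) gen by (intro bexI[of _ \<zero>]) (auto simp: a_minus_def)
  next
    case (insert c U)
    define T where "T = S - insert c U"
    have T: "finite T" "c \<notin> T" and Tc: "S - U = insert c T" and TS: "T \<subseteq> S"
      using insert S(1) by (auto simp: T_def)
    have [simp]: "e s \<in> carrier R" if "s \<in> T" for s using that TS by auto
    have c [simp]: "e c \<in> carrier R" using insert.prems S(2) by auto
    obtain p where p: "p \<in> P"
      and span: "\<And>x. x \<in> carrier R \<Longrightarrow>
        \<exists>g\<in>insert c T \<rightarrow> P. (\<one> \<ominus> a \<otimes> p) \<otimes> x = (\<Oplus>s\<in>insert c T. g s \<otimes> e s)"
      using insert.IH insert.prems unfolding Tc by blast
    define u where "u = \<one> \<ominus> a \<otimes> p"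
    have uP: "u \<in> P" unfolding u_def using a p Pcl by auto
    obtain h where h: "h \<in> insert c T \<rightarrow> P"
      and ubc: "u \<otimes> (b \<otimes> e c) = (\<Oplus>s\<in>insert c T. h s \<otimes> e s)"
      using span[of "b \<otimes> e c"] b by (auto simp: u_def)
    have hP [simp]: "h s \<in> P" if "s \<in> insert c T" for s using h that by auto
    \<comment> \<open>The coefficient of \<open>e c\<close> in \<open>u \<otimes> e c\<close> will
      turn out to be \<open>a \<otimes> h c\<close>; after subtracting it,
      \<open>w \<otimes> e c\<close> lies in the span of the generators in \<open>T\<close>.\<close>
    define w where "w = u \<ominus> a \<otimes> h c"
    have wP: "w \<in> P" unfolding w_def using a uP Pcl by auto
    \<comment> \<open>Right invertibility enters here: \<open>e c\<close> is a left multiple by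
      \<open>a\<close>, so the coefficients of \<open>u \<otimes> e c\<close> can be chosen
      divisible by \<open>a\<close>.\<close>
    have abc: "a \<otimes> (b \<otimes> e c) = e c"
      using ab b by (simp add: m_assoc[symmetric])
    have "u \<otimes> e c = u \<otimes> (a \<otimes> (b \<otimes> e c))" by (simp only: abc)
    also have "\<dots> = a \<otimes> (u \<otimes> (b \<otimes> e c))"
      using P.sub_m_comm[OF a uP] uP b by (simp add: m_assoc[symmetric])
    also have "\<dots> = a \<otimes> (h c \<otimes> e c \<oplus> (\<Oplus>s\<in>T. h s \<otimes> e s))"
      unfolding ubc using T by (subst finsum_insert) auto
    also have "\<dots> = a \<otimes> h c \<otimes> e c \<oplus> (\<Oplus>s\<in>T. a \<otimes> h s \<otimes> e s)"
      using T(1) by (subst r_distr)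
        (auto simp: m_assoc finsum_rdistr Pi_def intro!: finsum_closed finsum_cong')
    finally have uc: "u \<otimes> e c = a \<otimes> h c \<otimes> e c \<oplus> (\<Oplus>s\<in>T. a \<otimes> h s \<otimes> e s)" .
    have [simp]: "(\<Oplus>s\<in>T. a \<otimes> h s \<otimes> e s) \<in> carrier R" by (intro finsum_closed) auto
    have wc: "w \<otimes> e c = (\<Oplus>s\<in>T. a \<otimes> h s \<otimes> e s)"
      unfolding w_def using uc uP by (simp add: a_minus_def l_distr l_minus a_ac r_neg2 r_neg1)
    \<comment> \<open>Read off from \<open>w \<otimes> u\<close> by expanding one factor
      \<open>u\<close>. The product has to be used: \<open>u\<close> first maps \<open>x\<close>
      into the old span, and \<open>w\<close> then eliminates \<open>e c\<close> from it.\<close>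
    let ?p = "p \<oplus> (p \<otimes> u \<oplus> h c \<otimes> u)"
    have hc: "h c \<in> carrier R" using hP by auto
    have "u \<otimes> u = u \<ominus> a \<otimes> p \<otimes> u"
      using p uP by (subst u_def) (simp add: a_minus_def l_distr l_minus)
    moreover have "w \<otimes> u = u \<otimes> u \<ominus> a \<otimes> h c \<otimes> u"
      unfolding w_def using uP hc by (simp add: a_minus_def l_distr l_minus)
    ultimately have wu: "w \<otimes> u = \<one> \<ominus> a \<otimes> ?p"
      using p uP hc by (simp add: u_def[symmetric] a_minus_def r_distr minus_add a_assoc m_assoc)
        (simp add: u_def a_minus_def a_assoc)
    have pP: "?p \<in> P" using p uP Pcl hP by auto
    have "\<exists>g\<in>T \<rightarrow> P. (\<one> \<ominus> a \<otimes> ?p) \<otimes> x = (\<Oplus>s\<in>T. g s \<otimes> e s)" if x: "x \<in> carrier R" for x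
    proof -
      obtain g where g: "g \<in> insert c T \<rightarrow> P"
        and ux: "u \<otimes> x = (\<Oplus>s\<in>insert c T. g s \<otimes> e s)"
        using span[OF x] by (auto simp: u_def)
      have gP [simp]: "g s \<in> P" if "s \<in> insert c T" for s using g that by auto
      have gR: "g c \<in> carrier R" using gP by auto
      have "(w \<otimes> u) \<otimes> x = w \<otimes> (g c \<otimes> e c \<oplus> (\<Oplus>s\<in>T. g s \<otimes> e s))"
        using x wP uP ux T by (subst m_assoc) (auto simp: finsum_insert)
      also have "\<dots> = w \<otimes> (g c \<otimes> e c) \<oplus> w \<otimes> (\<Oplus>s\<in>T. g s \<otimes> e s)"
        using wP gR by (intro r_distr) (auto intro!: finsum_closed)
      also have "w \<otimes> (g c \<otimes> e c) = g c \<otimes> (w \<otimes> e c)"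
        using P.sub_m_comm[of w "g c"] wP gR by (simp add: m_assoc[symmetric])
      also have "\<dots> = (\<Oplus>s\<in>T. g c \<otimes> (a \<otimes> h s \<otimes> e s))"
        unfolding wc using gR T by (intro finsum_rdistr) auto
      also have "w \<otimes> (\<Oplus>s\<in>T. g s \<otimes> e s) = (\<Oplus>s\<in>T. w \<otimes> (g s \<otimes> e s))"
        using wP T by (intro finsum_rdistr) auto
      also have "(\<Oplus>s\<in>T. g c \<otimes> (a \<otimes> h s \<otimes> e s)) \<oplus> (\<Oplus>s\<in>T. w \<otimes> (g s \<otimes> e s))
          = (\<Oplus>s\<in>T. g c \<otimes> (a \<otimes> h s \<otimes> e s) \<oplus> w \<otimes> (g s \<otimes> e s))"
        using gR wP by (intro finsum_addf[symmetric]) auto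
      also have "\<dots> = (\<Oplus>s\<in>T. (g c \<otimes> (a \<otimes> h s) \<oplus> w \<otimes> g s) \<otimes> e s)"
        using gR wP by (intro finsum_cong') (auto simp: l_distr m_assoc)
      finally show ?thesis
        unfolding wu using Pcl wP a gP hP by (intro bexI[where x = "\<lambda>s. g c \<otimes> (a \<otimes> h s) \<oplus> w \<otimes> g s"]) auto
    qed
    then show ?case using pP unfolding T_def by blast
  qed
  \<comment> \<open>With every generator removed the span is zero, and \<open>x = \<one>\<close>
    gives the claim.\<close>
  from this[OF S(1)] obtain p where p: "p \<in> P" "\<forall>x\<in>carrier R. (\<one> \<ominus> a \<otimes> p) \<otimes> x = \<zero>"
    by (auto simp: finsum_empty)
  then have "\<one> \<ominus> a \<otimes> p = \<zero>" by (metis m_closed minus_closed one_closed PR a r_one)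
  then have "a \<otimes> p = \<one>" using p(1) by (metis PR aR m_closed one_closed r_right_minus_eq)
  then show ?thesis using p by auto
qed

section \<open>Incidence rings\<close>

text \<open>The incidence algebra of a locally finite preorder \<open>s\<close>. For finite
  \<open>L\<close> and \<open>s = L \<times> L\<close> it is the full matrix ring, so both rings
  needed for the inverses are instances of one construction.\<close>

definition incidence_ring ::
    "('r, 'm) ring_scheme \<Rightarrow> 'i set \<Rightarrow> ('i \<times> 'i) set \<Rightarrow> ('i \<times> 'i \<Rightarrow> 'r) ring" where
  "incidence_ring R L s =
     \<lparr>carrier = {A \<in> L \<times> L \<rightarrow>\<^sub>E carrier R. upper_triangular_mat R L s A},
      monoid.mult = mat_mult R L, one = mat_one R L,
      zero = (\<lambda>x \<in> L \<times> L. \<zero>\<^bsub>R\<^esub>), add = (\<lambda>A B. \<lambda>x \<in> L \<times> L. A x \<oplus>\<^bsub>R\<^esub> B x)\<rparr>"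

lemma incidence_ring_simps [simp]:
  "monoid.mult (incidence_ring R L s) = mat_mult R L"
  "one (incidence_ring R L s) = mat_one R L"
  "zero (incidence_ring R L s) = (\<lambda>x \<in> L \<times> L. \<zero>\<^bsub>R\<^esub>)"
  "add (incidence_ring R L s) = (\<lambda>A B. \<lambda>x \<in> L \<times> L. A x \<oplus>\<^bsub>R\<^esub> B x)"
  by (simp_all add: incidence_ring_def)

lemma incidence_ring_carrier:
  "A \<in> carrier (incidence_ring R L s) \<longleftrightarrow>
     A \<in> L \<times> L \<rightarrow>\<^sub>E carrier R \<and> (\<forall>i\<in>L. \<forall>j\<in>L. (i, j) \<notin> s \<longrightarrow> A (i, j) = \<zero>\<^bsub>R\<^esub>)"
  by (auto simp: incidence_ring_def upper_triangular_mat_def)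

lemma matrix_eqI:
  assumes "A \<in> extensional (L \<times> L)" "B \<in> extensional (L \<times> L)"
    and "\<And>i j. i \<in> L \<Longrightarrow> j \<in> L \<Longrightarrow> A (i, j) = B (i, j)"
  shows "A = B"
  using assms by (intro extensionalityI[of A "L \<times> L" B]) auto

text \<open>The sum in \<open>mat_mult\<close> runs over a set that varies with the matrices.
  Padding with zero terms replaces it by a set fixed in advance, over which different products can
  be compared.\<close>

lemma (in cring) mat_mult_entry:
  assumes "A \<in> L \<times> L \<rightarrow> carrier R" "B \<in> L \<times> L \<rightarrow> carrier R" "i \<in> L" "j \<in> L"
    and F: "finite F" "F \<subseteq> L"
    and supp: "\<And>k. k \<in> L \<Longrightarrow> k \<notin> F \<Longrightarrow> A (i, k) = \<zero> \<or> B (k, j) = \<zero>"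
  shows "mat_mult R L A B (i, j) = (\<Oplus>k\<in>F. A (i, k) \<otimes> B (k, j))"
proof -
  have cl: "A (i, k) \<in> carrier R" "B (k, j) \<in> carrier R" if "k \<in> L" for k
    using assms that by auto
  have "{k \<in> L. A (i, k) \<otimes> B (k, j) \<noteq> \<zero>} \<subseteq> F"
    using supp cl by fastforce
  then have "(\<Oplus>k\<in>{k \<in> L. A (i, k) \<otimes> B (k, j) \<noteq> \<zero>}. A (i, k) \<otimes> B (k, j))
      = (\<Oplus>k\<in>F. A (i, k) \<otimes> B (k, j))"
    using F cl by (intro add.finprod_mono_neutral_cong_left) auto
  then show ?thesis using assms by (simp add: mat_mult_def)
qed

text \<open>Local finiteness is what keeps products finite: a term with index \<open>k\<close> in
  the entry \<open>(i, j)\<close> can be nonzero only for \<open>k\<close> in the interval from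
  \<open>i\<close> to \<open>j\<close>.\<close>

locale incidence_cring = cring R for R (structure) +
  fixes L :: "'i set" and s :: "('i \<times> 'i) set"
  assumes preorder: "preorder_on L s"
    and finite_interval: "finite (preorder_interval L s i j)"
begin

abbreviation "K \<equiv> incidence_ring R L s"

lemma s_refl: "i \<in> L \<Longrightarrow> (i, i) \<in> s"
  using preorder by (auto simp: preorder_on_def refl_on_def)

lemma s_trans: "(i, j) \<in> s \<Longrightarrow> (j, k) \<in> s \<Longrightarrow> (i, k) \<in> s"
  using preorder by (auto simp: preorder_on_def trans_def)

lemma s_field: "(i, j) \<in> s \<Longrightarrow> i \<in> L \<and> j \<in> L"
  using preorder by (auto simp: preorder_on_def)

lemma mem_interval: "k \<in> preorder_interval L s i j \<longleftrightarrow> (i, k) \<in> s \<and> (k, j) \<in> s"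
  using s_field by (auto simp: preorder_interval_def)

lemma interval_subset: "preorder_interval L s i j \<subseteq> L"
  by (auto simp: preorder_interval_def)

lemma incidenceD:
  assumes "A \<in> carrier K"
  shows "A \<in> L \<times> L \<rightarrow> carrier R" "A \<in> extensional (L \<times> L)"
    "i \<in> L \<Longrightarrow> j \<in> L \<Longrightarrow> A (i, j) \<in> carrier R"
    "i \<in> L \<Longrightarrow> j \<in> L \<Longrightarrow> (i, j) \<notin> s \<Longrightarrow> A (i, j) = \<zero>"
  using assms by (auto simp: incidence_ring_carrier PiE_iff)

lemma mult_entry:
  assumes "A \<in> carrier K" "B \<in> carrier K" "i \<in> L" "j \<in> L"
    and "finite F" "F \<subseteq> L" "preorder_interval L s i j \<subseteq> F"
  shows "mat_mult R L A B (i, j) = (\<Oplus>k\<in>F. A (i, k) \<otimes> B (k, j))"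
proof (rule mat_mult_entry)
  show "A (i, k) = \<zero> \<or> B (k, j) = \<zero>" if "k \<in> L" "k \<notin> F" for k
  proof -
    have "(i, k) \<notin> s \<or> (k, j) \<notin> s" using assms(7) that mem_interval by blast
    then show ?thesis using assms that by (auto intro: incidenceD)
  qed
qed (use assms incidenceD in auto)

lemma mult_entry_interval:
  assumes "A \<in> carrier K" "B \<in> carrier K" "i \<in> L" "j \<in> L"
  shows "mat_mult R L A B (i, j) = (\<Oplus>k\<in>preorder_interval L s i j. A (i, k) \<otimes> B (k, j))"
  using assms by (intro mult_entry) (auto simp: finite_interval interval_subset)

lemma mult_closed:
  assumes "A \<in> carrier K" "B \<in> carrier K"
  shows "mat_mult R L A B \<in> carrier K"
  unfolding incidence_ring_carrier
proof (intro conjI ballI impI)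
  have "mat_mult R L A B (i, j) \<in> carrier R" if "i \<in> L" "j \<in> L" for i j
    unfolding mult_entry_interval[OF assms that] using that assms
    by (auto simp: preorder_interval_def intro!: finsum_closed m_closed incidenceD(3))
  then show "mat_mult R L A B \<in> L \<times> L \<rightarrow>\<^sub>E carrier R"
    by (intro PiE_I) (auto simp: mat_mult_def)
  show "mat_mult R L A B (i, j) = \<zero>" if "i \<in> L" "j \<in> L" "(i, j) \<notin> s" for i j
  proof -
    have "preorder_interval L s i j = {}" using that s_trans mem_interval by blast
    then show ?thesis using that assms by (simp add: mult_entry_interval finsum_empty)
  qed
qed

lemma one_closed: "mat_one R L \<in> carrier K"
  by (auto simp: incidence_ring_carrier mat_one_def s_refl)

lemma mult_one:
  assumes A: "A \<in> carrier K"
  shows "mat_mult R L (mat_one R L) A = A" "mat_mult R L A (mat_one R L) = A"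
proof -
  have "mat_mult R L (mat_one R L) A (i, j) = A (i, j)" if "i \<in> L" "j \<in> L" for i j
  proof -
    have "mat_mult R L (mat_one R L) A (i, j) = (\<Oplus>k\<in>{i}. mat_one R L (i, k) \<otimes> A (k, j))"
      using that A one_closed
      by (intro mat_mult_entry incidenceD(1)) (auto simp: mat_one_def)
    then show ?thesis using that A by (simp add: mat_one_def incidenceD)
  qed
  then show "mat_mult R L (mat_one R L) A = A"
    using A by (intro matrix_eqI[of _ L]) (auto simp: mat_mult_def incidenceD(2))
  have "mat_mult R L A (mat_one R L) (i, j) = A (i, j)" if "i \<in> L" "j \<in> L" for i j
  proof -
    have "mat_mult R L A (mat_one R L) (i, j) = (\<Oplus>k\<in>{j}. A (i, k) \<otimes> mat_one R L (k, j))"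
      using that A one_closed
      by (intro mat_mult_entry incidenceD(1)) (auto simp: mat_one_def)
    then show ?thesis using that A by (simp add: mat_one_def incidenceD)
  qed
  then show "mat_mult R L A (mat_one R L) = A"
    using A by (intro matrix_eqI[of _ L]) (auto simp: mat_mult_def incidenceD(2))
qed

text \<open>All inner sums are taken over the interval from \<open>i\<close> to \<open>j\<close>,
  which by transitivity contains the intervals from \<open>i\<close> to \<open>k\<close> and from
  \<open>l\<close> to \<open>j\<close> for its elements \<open>k\<close> and \<open>l\<close>. The
  double sum is then over a rectangle and can be swapped.\<close>

lemma mult_assoc:
  assumes A: "A \<in> carrier K" and B: "B \<in> carrier K" and C: "C \<in> carrier K"
  shows "mat_mult R L (mat_mult R L A B) C = mat_mult R L A (mat_mult R L B C)"
proof (rule matrix_eqI[of _ L])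
  fix i j assume ij: "i \<in> L" "j \<in> L"
  let ?F = "preorder_interval L s i j"
  have F: "finite ?F" "?F \<subseteq> L" "\<And>k. k \<in> ?F \<Longrightarrow> k \<in> L"
    by (auto simp: finite_interval interval_subset dest: interval_subset[THEN subsetD])
  note [simp] = incidenceD(3)[OF A] incidenceD(3)[OF B] incidenceD(3)[OF C] F(1,3)
  have "mat_mult R L (mat_mult R L A B) C (i, j)
      = (\<Oplus>k\<in>?F. mat_mult R L A B (i, k) \<otimes> C (k, j))"
    using A B C ij by (intro mult_entry_interval mult_closed)
  also have "\<dots> = (\<Oplus>k\<in>?F. (\<Oplus>l\<in>?F. A (i, l) \<otimes> B (l, k)) \<otimes> C (k, j))"
  proof (intro finsum_cong' refl)
    fix k assume k: "k \<in> ?F"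
    then have "preorder_interval L s i k \<subseteq> ?F" using s_trans mem_interval by blast
    then show "mat_mult R L A B (i, k) \<otimes> C (k, j)
        = (\<Oplus>l\<in>?F. A (i, l) \<otimes> B (l, k)) \<otimes> C (k, j)"
      using A B ij F k by (subst mult_entry) auto
  qed (use ij in \<open>auto intro!: m_closed finsum_closed\<close>)
  also have "\<dots> = (\<Oplus>k\<in>?F. \<Oplus>l\<in>?F. A (i, l) \<otimes> B (l, k) \<otimes> C (k, j))"
    using ij by (intro finsum_cong' refl finsum_ldistr) (auto intro!: finsum_closed)
  also have "\<dots> = (\<Oplus>l\<in>?F. \<Oplus>k\<in>?F. A (i, l) \<otimes> B (l, k) \<otimes> C (k, j))"
    using ij by (intro finsum_swap) auto
  also have "\<dots> = (\<Oplus>l\<in>?F. A (i, l) \<otimes> (\<Oplus>k\<in>?F. B (l, k) \<otimes> C (k, j)))"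
  proof (intro finsum_cong' refl)
    fix l assume "l \<in> ?F"
    then show "(\<Oplus>k\<in>?F. A (i, l) \<otimes> B (l, k) \<otimes> C (k, j))
        = A (i, l) \<otimes> (\<Oplus>k\<in>?F. B (l, k) \<otimes> C (k, j))"
      using ij by (subst finsum_rdistr) (auto simp: m_assoc intro!: finsum_cong')
  qed (use ij in \<open>auto intro!: m_closed finsum_closed\<close>)
  also have "\<dots> = (\<Oplus>l\<in>?F. A (i, l) \<otimes> mat_mult R L B C (l, j))"
  proof (intro finsum_cong' refl)
    fix l assume l: "l \<in> ?F"
    then have "preorder_interval L s l j \<subseteq> ?F" using s_trans mem_interval by blast
    then show "A (i, l) \<otimes> (\<Oplus>k\<in>?F. B (l, k) \<otimes> C (k, j)) = A (i, l) \<otimes> mat_mult R L B C (l, j)"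
      using B C ij F l by (subst mult_entry) auto
  qed (use ij incidenceD(3)[OF mult_closed[OF B C]] in \<open>auto intro!: m_closed\<close>)
  also have "\<dots> = mat_mult R L A (mat_mult R L B C) (i, j)"
    using A B C ij by (intro mult_entry_interval[symmetric] mult_closed)
  finally show "mat_mult R L (mat_mult R L A B) C (i, j)
      = mat_mult R L A (mat_mult R L B C) (i, j)" .
qed (auto simp: mat_mult_def)

lemma mult_distrib:
  assumes A: "A \<in> carrier K" and B: "B \<in> carrier K" and C: "C \<in> carrier K"
  shows "(A \<oplus>\<^bsub>K\<^esub> B) \<otimes>\<^bsub>K\<^esub> C = A \<otimes>\<^bsub>K\<^esub> C \<oplus>\<^bsub>K\<^esub> B \<otimes>\<^bsub>K\<^esub> C"
    and "C \<otimes>\<^bsub>K\<^esub> (A \<oplus>\<^bsub>K\<^esub> B) = C \<otimes>\<^bsub>K\<^esub> A \<oplus>\<^bsub>K\<^esub> C \<otimes>\<^bsub>K\<^esub> B"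
proof -
  have AB: "A \<oplus>\<^bsub>K\<^esub> B \<in> carrier K"
    using A B by (auto simp: incidence_ring_carrier)
  note cl = incidenceD(3)[OF A] incidenceD(3)[OF B] incidenceD(3)[OF C] interval_subset[THEN subsetD]
  show "(A \<oplus>\<^bsub>K\<^esub> B) \<otimes>\<^bsub>K\<^esub> C = A \<otimes>\<^bsub>K\<^esub> C \<oplus>\<^bsub>K\<^esub> B \<otimes>\<^bsub>K\<^esub> C"
  proof (rule matrix_eqI[of _ L])
    fix i j assume ij: "i \<in> L" "j \<in> L"
    have "((A \<oplus>\<^bsub>K\<^esub> B) \<otimes>\<^bsub>K\<^esub> C) (i, j)
        = (\<Oplus>k\<in>preorder_interval L s i j. A (i, k) \<otimes> C (k, j) \<oplus> B (i, k) \<otimes> C (k, j))"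
      unfolding incidence_ring_simps(1) mult_entry_interval[OF AB C ij]
      using ij cl by (intro finsum_cong') (auto simp: l_distr)
    also have "\<dots> = (A \<otimes>\<^bsub>K\<^esub> C \<oplus>\<^bsub>K\<^esub> B \<otimes>\<^bsub>K\<^esub> C) (i, j)"
      using A B C ij cl by (simp add: mult_entry_interval finsum_addf Pi_def)
    finally show "((A \<oplus>\<^bsub>K\<^esub> B) \<otimes>\<^bsub>K\<^esub> C) (i, j) = (A \<otimes>\<^bsub>K\<^esub> C \<oplus>\<^bsub>K\<^esub> B \<otimes>\<^bsub>K\<^esub> C) (i, j)" .
  qed (auto simp: mat_mult_def)
  show "C \<otimes>\<^bsub>K\<^esub> (A \<oplus>\<^bsub>K\<^esub> B) = C \<otimes>\<^bsub>K\<^esub> A \<oplus>\<^bsub>K\<^esub> C \<otimes>\<^bsub>K\<^esub> B"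
  proof (rule matrix_eqI[of _ L])
    fix i j assume ij: "i \<in> L" "j \<in> L"
    have "(C \<otimes>\<^bsub>K\<^esub> (A \<oplus>\<^bsub>K\<^esub> B)) (i, j)
        = (\<Oplus>k\<in>preorder_interval L s i j. C (i, k) \<otimes> A (k, j) \<oplus> C (i, k) \<otimes> B (k, j))"
      unfolding incidence_ring_simps(1) mult_entry_interval[OF C AB ij]
      using ij cl by (intro finsum_cong') (auto simp: r_distr)
    also have "\<dots> = (C \<otimes>\<^bsub>K\<^esub> A \<oplus>\<^bsub>K\<^esub> C \<otimes>\<^bsub>K\<^esub> B) (i, j)"
      using A B C ij cl by (simp add: mult_entry_interval finsum_addf Pi_def)
    finally show "(C \<otimes>\<^bsub>K\<^esub> (A \<oplus>\<^bsub>K\<^esub> B)) (i, j) = (C \<otimes>\<^bsub>K\<^esub> A \<oplus>\<^bsub>K\<^esub> C \<otimes>\<^bsub>K\<^esub> B) (i, j)" .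
  qed (auto simp: mat_mult_def)
qed

lemma incidence_ring: "ring K"
proof (rule ringI)
  show "abelian_group K"
  proof (rule abelian_groupI)
    fix A assume A: "A \<in> carrier K"
    then have "(\<lambda>x\<in>L \<times> L. \<ominus> A x) \<in> carrier K"
      unfolding incidence_ring_carrier by (intro conjI) auto
    moreover have "(\<lambda>x\<in>L \<times> L. \<ominus> A x) \<oplus>\<^bsub>K\<^esub> A = \<zero>\<^bsub>K\<^esub>"
      using A by (intro matrix_eqI[of _ L]) (auto simp: incidenceD l_neg)
    ultimately show "\<exists>B\<in>carrier K. B \<oplus>\<^bsub>K\<^esub> A = \<zero>\<^bsub>K\<^esub>" by blast
  next
    fix A B assume "A \<in> carrier K" "B \<in> carrier K"
    then show "A \<oplus>\<^bsub>K\<^esub> B \<in> carrier K" by (auto simp: incidence_ring_carrier)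
  next
    show "\<zero>\<^bsub>K\<^esub> \<in> carrier K" by (auto simp: incidence_ring_carrier)
  next
    fix A B C assume "A \<in> carrier K" "B \<in> carrier K" "C \<in> carrier K"
    then show "A \<oplus>\<^bsub>K\<^esub> B \<oplus>\<^bsub>K\<^esub> C = A \<oplus>\<^bsub>K\<^esub> (B \<oplus>\<^bsub>K\<^esub> C)"
      by (intro matrix_eqI[of _ L]) (auto simp: incidenceD a_assoc)
  next
    fix A B assume "A \<in> carrier K" "B \<in> carrier K"
    then show "A \<oplus>\<^bsub>K\<^esub> B = B \<oplus>\<^bsub>K\<^esub> A"
      by (intro matrix_eqI[of _ L]) (auto simp: incidenceD intro: a_comm)
  next
    fix A assume "A \<in> carrier K"
    then show "\<zero>\<^bsub>K\<^esub> \<oplus>\<^bsub>K\<^esub> A = A"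
      by (intro matrix_eqI[of _ L]) (auto simp: incidenceD)
  qed
  show "monoid K"
    by (rule monoidI; unfold incidence_ring_simps; intro mult_closed one_closed mult_one mult_assoc)
  show "(A \<oplus>\<^bsub>K\<^esub> B) \<otimes>\<^bsub>K\<^esub> C = A \<otimes>\<^bsub>K\<^esub> C \<oplus>\<^bsub>K\<^esub> B \<otimes>\<^bsub>K\<^esub> C"
    if "A \<in> carrier K" "B \<in> carrier K" "C \<in> carrier K" for A B C
    using that by (rule mult_distrib)
  show "C \<otimes>\<^bsub>K\<^esub> (A \<oplus>\<^bsub>K\<^esub> B) = C \<otimes>\<^bsub>K\<^esub> A \<oplus>\<^bsub>K\<^esub> C \<otimes>\<^bsub>K\<^esub> B"
    if "A \<in> carrier K" "B \<in> carrier K" "C \<in> carrier K" for A B C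
    using that by (rule mult_distrib)
qed

end

section \<open>Inverses of finite triangular matrices\<close>

lemma (in incidence_cring) finsum_entry:
  assumes f: "f \<in> S \<rightarrow> carrier K" and ij: "i \<in> L" "j \<in> L"
  shows "finsum K f S (i, j) = (\<Oplus>x\<in>S. f x (i, j))"
proof -
  interpret K: ring K by (rule incidence_ring)
  show ?thesis
    using f
  proof (induction S rule: infinite_finite_induct)
    case (insert x S)
    then have "finsum K f (insert x S) (i, j) = f x (i, j) \<oplus> finsum K f S (i, j)"
      using ij by (subst K.finsum_insert) auto
    then show ?case
      using insert ij by (subst finsum_insert) (auto intro: incidenceD(3))
  qed (use ij in \<open>auto simp: K.finsum_infinite finsum_infinite\<close>)
qed

lemma (in cring) incidence_cring_full:
  assumes "finite D"
  shows "incidence_cring R D (D \<times> D)"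
  using assms
  by unfold_locales (auto simp: preorder_on_def refl_on_def trans_def preorder_interval_def)

text \<open>\<open>Units\<close> depends only on the carrier, the product and the one, so adding an
  additive structure changes nothing.\<close>

lemma Units_mat_struct: "Units (mat_struct R D) = Units (incidence_ring R D (D \<times> D))"
  by (auto simp: Units_def mat_struct_def incidence_ring_def upper_triangular_mat_def)

text \<open>The coefficients in Nakayama's lemma must be elements of the subring itself, so scalars
  have to act through matrices.\<close>

definition scalar_mat :: "('r, 'm) ring_scheme \<Rightarrow> 'i set \<Rightarrow> 'r \<Rightarrow> 'i \<times> 'i \<Rightarrow> 'r" where
  "scalar_mat R L c = (\<lambda>(i, j) \<in> L \<times> L. if i = j then c else \<zero>\<^bsub>R\<^esub>)"

lemma (in incidence_cring) scalar_mat: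
  assumes c: "c \<in> carrier R"
  shows "scalar_mat R L c \<in> carrier K"
    and "A \<in> carrier K \<Longrightarrow> mat_mult R L (scalar_mat R L c) A = (\<lambda>x \<in> L \<times> L. c \<otimes> A x)"
    and "A \<in> carrier K \<Longrightarrow> mat_mult R L A (scalar_mat R L c) = (\<lambda>x \<in> L \<times> L. c \<otimes> A x)"
proof -
  show S: "scalar_mat R L c \<in> carrier K"
    using c by (auto simp: incidence_ring_carrier scalar_mat_def s_refl)
  assume A: "A \<in> carrier K"
  have "mat_mult R L (scalar_mat R L c) A (i, j) = c \<otimes> A (i, j)" if "i \<in> L" "j \<in> L" for i j
  proof -
    have "mat_mult R L (scalar_mat R L c) A (i, j) = (\<Oplus>k\<in>{i}. scalar_mat R L c (i, k) \<otimes> A (k, j))"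
      using that A S by (intro mat_mult_entry incidenceD(1)) (auto simp: scalar_mat_def)
    then show ?thesis using that A c by (simp add: scalar_mat_def incidenceD)
  qed
  then show "mat_mult R L (scalar_mat R L c) A = (\<lambda>x \<in> L \<times> L. c \<otimes> A x)"
    by (intro matrix_eqI[of _ L]) (auto simp: mat_mult_def)
  have "mat_mult R L A (scalar_mat R L c) (i, j) = c \<otimes> A (i, j)" if "i \<in> L" "j \<in> L" for i j
  proof -
    have "mat_mult R L A (scalar_mat R L c) (i, j) = (\<Oplus>k\<in>{j}. A (i, k) \<otimes> scalar_mat R L c (k, j))"
      using that A S by (intro mat_mult_entry incidenceD(1)) (auto simp: scalar_mat_def)
    then show ?thesis using that A c by (simp add: scalar_mat_def incidenceD m_comm)
  qed
  then show "mat_mult R L A (scalar_mat R L c) = (\<lambda>x \<in> L \<times> L. c \<otimes> A x)"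
    by (intro matrix_eqI[of _ L]) (auto simp: mat_mult_def)
qed

text \<open>
  The subring \<open>P\<close> to which \<open>right_inverse_in_subcring\<close> is applied consists of the triangular
  matrices in the bicommutant of \<open>A\<close>; this makes it commutative.
\<close>

lemma (in incidence_cring) triangular_inverse:
  assumes L: "finite L" and A: "A \<in> carrier K" and unit: "A \<in> Units (mat_struct R L)"
  shows "A \<in> Units K"
proof -
  let ?F = "incidence_ring R L (L \<times> L)"
  interpret full: incidence_cring R L "L \<times> L" using L by (rule incidence_cring_full)
  interpret F: ring ?F by (rule full.incidence_ring)
  interpret K: ring K by (rule incidence_ring)
  have KF: "X \<in> carrier ?F" if "X \<in> carrier K" for X
    using that by (auto simp: incidence_ring_carrier)
  have ops: "X \<otimes>\<^bsub>K\<^esub> Y = X \<otimes>\<^bsub>?F\<^esub> Y" "X \<oplus>\<^bsub>K\<^esub> Y = X \<oplus>\<^bsub>?F\<^esub> Y" "\<one>\<^bsub>K\<^esub> = \<one>\<^bsub>?F\<^esub>" for X Y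
    by simp_all
  \<comment> \<open>Unlike sum and product, the additive inverse is determined by a description over
    the carrier, so its values in the two rings agree only by an argument.\<close>
  have minus: "\<ominus>\<^bsub>K\<^esub> X = \<ominus>\<^bsub>?F\<^esub> X" if X: "X \<in> carrier K" for X
  proof (rule F.minus_equality[symmetric])
    show "\<ominus>\<^bsub>K\<^esub> X \<oplus>\<^bsub>?F\<^esub> X = \<zero>\<^bsub>?F\<^esub>" using K.l_neg[OF X] by simp
  qed (use X KF K.a_inv_closed in auto)
  define P where "P = {X \<in> carrier K. \<forall>Y\<in>carrier ?F.
    A \<otimes>\<^bsub>?F\<^esub> Y = Y \<otimes>\<^bsub>?F\<^esub> A \<longrightarrow> X \<otimes>\<^bsub>?F\<^esub> Y = Y \<otimes>\<^bsub>?F\<^esub> X}"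
  have AP: "A \<in> P" unfolding P_def using A by blast
  have PI: "X \<in> P" if "X \<in> carrier K" "\<And>Y. Y \<in> carrier ?F \<Longrightarrow> A \<otimes>\<^bsub>?F\<^esub> Y = Y \<otimes>\<^bsub>?F\<^esub> A
      \<Longrightarrow> X \<otimes>\<^bsub>?F\<^esub> Y = Y \<otimes>\<^bsub>?F\<^esub> X" for X
    unfolding P_def using that by blast
  have PK: "X \<in> carrier K" if "X \<in> P" for X using that unfolding P_def by blast
  have Pcomm: "X \<otimes>\<^bsub>?F\<^esub> Y = Y \<otimes>\<^bsub>?F\<^esub> X"
    if "X \<in> P" "Y \<in> carrier ?F" "A \<otimes>\<^bsub>?F\<^esub> Y = Y \<otimes>\<^bsub>?F\<^esub> A" for X Y
    using that unfolding P_def by blast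
  have "subcring P ?F"
  proof (intro subcring.intro subcring_axioms.intro)
    show "subring P ?F"
    proof (rule F.subringI)
      show "P \<subseteq> carrier ?F" using PK KF by blast
      show "\<one>\<^bsub>?F\<^esub> \<in> P"
        using K.one_closed by (intro PI) (simp_all only: ops F.l_one F.r_one)
    next
      fix X assume X: "X \<in> P"
      note XF = KF[OF PK[OF X]]
      show "\<ominus>\<^bsub>?F\<^esub> X \<in> P"
      proof (rule PI)
        show "\<ominus>\<^bsub>?F\<^esub> X \<in> carrier K"
          using K.a_inv_closed[OF PK[OF X]] minus[OF PK[OF X]] by argo
      qed (use XF Pcomm[OF X] in \<open>simp only: F.l_minus F.r_minus\<close>)
    next
      fix X Y assume X: "X \<in> P" and Y: "Y \<in> P"
      note cl = KF[OF PK[OF X]] KF[OF PK[OF Y]]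
      show "X \<otimes>\<^bsub>?F\<^esub> Y \<in> P"
      proof (rule PI)
        show "X \<otimes>\<^bsub>?F\<^esub> Y \<in> carrier K"
          using K.m_closed[OF PK[OF X] PK[OF Y]] by simp
      next
        fix Z assume Z: "Z \<in> carrier ?F" "A \<otimes>\<^bsub>?F\<^esub> Z = Z \<otimes>\<^bsub>?F\<^esub> A"
        show "X \<otimes>\<^bsub>?F\<^esub> Y \<otimes>\<^bsub>?F\<^esub> Z = Z \<otimes>\<^bsub>?F\<^esub> (X \<otimes>\<^bsub>?F\<^esub> Y)"
          using Pcomm[OF X Z] Pcomm[OF Y Z] cl Z(1) by (metis F.m_assoc)
      qed
      show "X \<oplus>\<^bsub>?F\<^esub> Y \<in> P"
      proof (rule PI)
        show "X \<oplus>\<^bsub>?F\<^esub> Y \<in> carrier K"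
          using K.a_closed[OF PK[OF X] PK[OF Y]] by simp
      next
        fix Z assume Z: "Z \<in> carrier ?F" "A \<otimes>\<^bsub>?F\<^esub> Z = Z \<otimes>\<^bsub>?F\<^esub> A"
        show "(X \<oplus>\<^bsub>?F\<^esub> Y) \<otimes>\<^bsub>?F\<^esub> Z = Z \<otimes>\<^bsub>?F\<^esub> (X \<oplus>\<^bsub>?F\<^esub> Y)"
          using Pcomm[OF X Z] Pcomm[OF Y Z] cl Z(1) by (simp only: F.l_distr F.r_distr)
      qed
    qed
    \<comment> \<open>\<open>A\<close> commutes with itself, so \<open>Y\<close> from
      \<open>P\<close> commutes with \<open>A\<close>; by the definition of \<open>P\<close>,
      \<open>X\<close> then commutes with \<open>Y\<close>.\<close>
    fix X Y assume X: "X \<in> P" and Y: "Y \<in> P"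
    show "X \<otimes>\<^bsub>?F\<^esub> Y = Y \<otimes>\<^bsub>?F\<^esub> X"
      using Pcomm[OF X KF[OF PK[OF Y]] Pcomm[OF Y KF[OF A] refl, symmetric]] .
  qed
  define e where "e = (\<lambda>pq. \<lambda>x \<in> L \<times> L. if x = pq then \<one> else \<zero>)"
  have eF: "e pq \<in> carrier ?F" for pq by (auto simp: e_def incidence_ring_carrier)
  \<comment> \<open>The elementary matrices generate the full ring over the scalar matrices. These
    are triangular and central, hence lie in \<open>P\<close>.\<close>
  have gen: "\<exists>g\<in>(L \<times> L) \<rightarrow> P. X = (\<Oplus>\<^bsub>?F\<^esub>pq\<in>L \<times> L. g pq \<otimes>\<^bsub>?F\<^esub> e pq)"
    if X: "X \<in> carrier ?F" for X
  proof
    note Xc = full.incidenceD(3)[OF X]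
    show "(\<lambda>pq. scalar_mat R L (X pq)) \<in> L \<times> L \<rightarrow> P"
      using Xc by (auto intro!: PI simp: scalar_mat full.scalar_mat)
    have cl: "scalar_mat R L (X pq) \<otimes>\<^bsub>?F\<^esub> e pq \<in> carrier ?F" if "pq \<in> L \<times> L" for pq
      using that Xc eF by (intro F.m_closed full.scalar_mat) auto
    show "X = (\<Oplus>\<^bsub>?F\<^esub>pq\<in>L \<times> L. scalar_mat R L (X pq) \<otimes>\<^bsub>?F\<^esub> e pq)"
    proof (rule matrix_eqI[of _ L])
      fix i j assume ij: "i \<in> L" "j \<in> L"
      have "(\<Oplus>\<^bsub>?F\<^esub>pq\<in>L \<times> L. scalar_mat R L (X pq) \<otimes>\<^bsub>?F\<^esub> e pq) (i, j)
          = (\<Oplus>pq\<in>L \<times> L. (scalar_mat R L (X pq) \<otimes>\<^bsub>?F\<^esub> e pq) (i, j))"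
        using cl ij by (intro full.finsum_entry) auto
      also have "\<dots> = (\<Oplus>pq\<in>L \<times> L. if (i, j) = pq then X pq else \<zero>)"
        using ij Xc eF by (intro finsum_cong') (auto simp: full.scalar_mat e_def split: if_splits)
      also have "\<dots> = X (i, j)"
        using ij Xc L by (intro add.finprod_singleton) auto
      finally show "X (i, j) = (\<Oplus>\<^bsub>?F\<^esub>pq\<in>L \<times> L. scalar_mat R L (X pq) \<otimes>\<^bsub>?F\<^esub> e pq) (i, j)" ..
    qed (use X cl in \<open>auto intro!: full.incidenceD(2) F.finsum_closed simp del: incidence_ring_simps\<close>)
  qed
  obtain B where B: "B \<in> carrier ?F" "B \<otimes>\<^bsub>?F\<^esub> A = \<one>\<^bsub>?F\<^esub>" "A \<otimes>\<^bsub>?F\<^esub> B = \<one>\<^bsub>?F\<^esub>"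
    using unit unfolding Units_mat_struct by (auto simp: Units_def simp del: incidence_ring_simps)
  obtain X where X: "X \<in> P" "A \<otimes>\<^bsub>?F\<^esub> X = \<one>\<^bsub>?F\<^esub>"
    using F.right_inverse_in_subcring[OF \<open>subcring P ?F\<close> _ _ gen AP B(1,3)] L eF by blast
  \<comment> \<open>A right inverse and a left inverse coincide, so the two-sided inverse
    \<open>B\<close> is the triangular matrix \<open>X\<close>.\<close>
  have "X = B"
    using F.inv_unique[OF B(2) X(2)] KF[OF A] KF[OF PK[OF X(1)]] B(1) by blast
  then have "X \<otimes>\<^bsub>K\<^esub> A = \<one>\<^bsub>K\<^esub>" "A \<otimes>\<^bsub>K\<^esub> X = \<one>\<^bsub>K\<^esub>" "X \<in> carrier K"
    using B X PK by (simp_all only: ops)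
  then show ?thesis using A unfolding Units_def by blast
qed

section \<open>Units of incidence rings\<close>

context incidence_cring
begin

section \<open>Restriction of triangular matrices to convex blocks\<close>

lemma incidence_cring_restrict:
  assumes "D \<subseteq> L"
  shows "incidence_cring R D (s \<inter> D \<times> D)"
proof unfold_locales
  show "preorder_on D (s \<inter> D \<times> D)"
    using assms preorder unfolding preorder_on_def refl_on_def trans_def by blast
  show "finite (preorder_interval D (s \<inter> D \<times> D) i j)" for i j
    using assms by (rule_tac finite_subset[OF _ finite_interval[of i j]])
      (auto simp: preorder_interval_def)
qed

lemma restrict_closed:
  assumes "A \<in> carrier K" "D \<subseteq> L"
  shows "restrict A (D \<times> D) \<in> carrier (incidence_ring R D (s \<inter> D \<times> D))"
  using assms by (auto simp: incidence_ring_carrier subset_iff)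

lemma restrict_one:
  assumes "D \<subseteq> L"
  shows "restrict (mat_one R L) (D \<times> D) = mat_one R D"
  using assms by (intro matrix_eqI[of _ D]) (auto simp: mat_one_def subset_iff)

text \<open>An entry with both indices in \<open>D\<close> is a sum over an interval with endpoints
  in \<open>D\<close>, and convexity keeps this interval inside \<open>D\<close>.\<close>

lemma restrict_mult:
  assumes A: "A \<in> carrier K" and B: "B \<in> carrier K" and D: "preorder_convex L s D"
  shows "restrict (mat_mult R L A B) (D \<times> D)
    = mat_mult R D (restrict A (D \<times> D)) (restrict B (D \<times> D))"
proof (rule matrix_eqI[of _ D])
  have DL: "D \<subseteq> L" using D by (simp add: preorder_convex_def)
  interpret D: incidence_cring R D "s \<inter> D \<times> D" using DL by (rule incidence_cring_restrict)
  fix i j assume ij: "i \<in> D" "j \<in> D"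
  let ?F = "preorder_interval L s i j"
  have F: "?F \<subseteq> D" using D ij by (auto simp: preorder_convex_def)
  have ijL: "i \<in> L" "j \<in> L" using ij DL by auto
  have "mat_mult R D (restrict A (D \<times> D)) (restrict B (D \<times> D)) (i, j)
      = (\<Oplus>k\<in>?F. restrict A (D \<times> D) (i, k) \<otimes> restrict B (D \<times> D) (k, j))"
    using ij F finite_interval
    by (intro D.mult_entry restrict_closed A B DL) (auto simp: D.mem_interval mem_interval)
  also have "\<dots> = (\<Oplus>k\<in>?F. A (i, k) \<otimes> B (k, j))"
    using ij ijL F interval_subset incidenceD(3)[OF A] incidenceD(3)[OF B]
    by (intro finsum_cong') (auto simp: subset_iff)
  also have "\<dots> = restrict (mat_mult R L A B) (D \<times> D) (i, j)"
    using ij by (simp add: mult_entry_interval[OF A B ijL])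
  finally show "restrict (mat_mult R L A B) (D \<times> D) (i, j)
      = mat_mult R D (restrict A (D \<times> D)) (restrict B (D \<times> D)) (i, j)" ..
qed (auto simp: mat_mult_def)

text \<open>The convex hull in a single step: by transitivity, a point between two points of such
  intervals lies between an endpoint of the first and an endpoint of the second.\<close>

definition interval_hull :: "'i set \<Rightarrow> 'i set" where
  "interval_hull F = (\<Union>a\<in>F. \<Union>b\<in>F. preorder_interval L s a b)"

lemma interval_hull:
  assumes "F \<subseteq> L"
  shows "F \<subseteq> interval_hull F" "finite F \<Longrightarrow> finite (interval_hull F)" "preorder_convex L s (interval_hull F)"
    "preorder_convex L s D \<Longrightarrow> F \<subseteq> D \<Longrightarrow> interval_hull F \<subseteq> D"
proof -
  show "F \<subseteq> interval_hull F"
  proof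
    fix x assume "x \<in> F"
    then have "x \<in> preorder_interval L s x x" using assms by (auto simp: mem_interval s_refl)
    with \<open>x \<in> F\<close> show "x \<in> interval_hull F" unfolding interval_hull_def by blast
  qed
  show "finite F \<Longrightarrow> finite (interval_hull F)" by (simp add: interval_hull_def finite_interval)
  show "preorder_convex L s D \<Longrightarrow> F \<subseteq> D \<Longrightarrow> interval_hull F \<subseteq> D"
    unfolding interval_hull_def preorder_convex_def by blast
  show "preorder_convex L s (interval_hull F)"
    unfolding preorder_convex_def
  proof (intro conjI ballI subsetI)
    show "x \<in> interval_hull F \<Longrightarrow> x \<in> L" for x using interval_subset by (auto simp: interval_hull_def)
    fix i j k assume "i \<in> interval_hull F" "j \<in> interval_hull F" "k \<in> preorder_interval L s i j"
    then show "k \<in> interval_hull F" using s_trans unfolding interval_hull_def UN_iff mem_interval by blast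
  qed
qed

text \<open>Restriction respects products and the one, hence inverses. This is used twice: to
  compare inverses of nested blocks, and to see that an entry of an inverse is determined by a
  finite block.\<close>

lemma restrict_inverse:
  assumes A: "A \<in> Units K" and D: "preorder_convex L s D"
  shows "restrict A (D \<times> D) \<in> Units (incidence_ring R D (s \<inter> D \<times> D))"
    and "inv\<^bsub>incidence_ring R D (s \<inter> D \<times> D)\<^esub> (restrict A (D \<times> D)) = restrict (inv\<^bsub>K\<^esub> A) (D \<times> D)"
proof -
  interpret K: ring K by (rule incidence_ring)
  have DL: "D \<subseteq> L" using D by (simp add: preorder_convex_def)
  let ?KD = "incidence_ring R D (s \<inter> D \<times> D)"
  interpret D: incidence_cring R D "s \<inter> D \<times> D" using DL by (rule incidence_cring_restrict)
  interpret KD: ring ?KD by (rule D.incidence_ring)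
  have AK: "A \<in> carrier K" "inv\<^bsub>K\<^esub> A \<in> carrier K" using A by auto
  have c: "restrict A (D \<times> D) \<in> carrier ?KD" "restrict (inv\<^bsub>K\<^esub> A) (D \<times> D) \<in> carrier ?KD"
    using AK DL by (auto intro: restrict_closed simp del: K.Units_inv_closed)
  have l: "restrict A (D \<times> D) \<otimes>\<^bsub>?KD\<^esub> restrict (inv\<^bsub>K\<^esub> A) (D \<times> D) = \<one>\<^bsub>?KD\<^esub>"
    using K.Units_r_inv[OF A] restrict_mult[OF AK D] restrict_one[OF DL] by simp
  have r: "restrict (inv\<^bsub>K\<^esub> A) (D \<times> D) \<otimes>\<^bsub>?KD\<^esub> restrict A (D \<times> D) = \<one>\<^bsub>?KD\<^esub>"
    using K.Units_l_inv[OF A] restrict_mult[OF AK(2,1) D] restrict_one[OF DL] by simp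
  show "restrict A (D \<times> D) \<in> Units ?KD"
    using c l r unfolding Units_def by blast
  show "inv\<^bsub>?KD\<^esub> (restrict A (D \<times> D)) = restrict (inv\<^bsub>K\<^esub> A) (D \<times> D)"
    using c l r by (intro KD.inv_char)
qed

lemma Units_nonsingular_restrict:
  assumes A: "A \<in> Units K" and D: "finite D" "preorder_convex L s D"
  shows "restrict A (D \<times> D) \<in> Units (mat_struct R D)"
proof -
  let ?KD = "incidence_ring R D (s \<inter> D \<times> D)"
  have "carrier ?KD \<subseteq> carrier (incidence_ring R D (D \<times> D))"
    by (auto simp: incidence_ring_carrier)
  then show ?thesis
    using restrict_inverse(1)[OF A D(2)] unfolding Units_mat_struct by (auto simp: Units_def)
qed

text \<open>For a nonsingular triangular matrix the inverse is glued entry by entry from the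
  inverses of the finite convex blocks beyond the threshold \<open>C\<close>.\<close>

theorem U_set_eq_Units: "U_set R L s = Units K"
proof
  interpret K: ring K by (rule incidence_ring)
  show "Units K \<subseteq> U_set R L s"
  proof
    fix A assume A: "A \<in> Units K"
    have "A \<in> carrier K" using A by auto
    \<comment> \<open>The threshold is the empty set: all finite convex blocks of a unit are
      invertible.\<close>
    moreover have "nonsingular_mat R L s A"
      unfolding nonsingular_mat_def using Units_nonsingular_restrict[OF A]
      by (intro exI[of _ "{}"]) (auto simp: preorder_convex_def)
    ultimately show "A \<in> U_set R L s" by (simp add: U_set_def incidence_ring_def)
  qed
  show "U_set R L s \<subseteq> Units K"
  proof
    fix A assume "A \<in> U_set R L s"
    then have A: "A \<in> carrier K" and "nonsingular_mat R L s A"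
      by (auto simp: U_set_def incidence_ring_def)
    then obtain C where C: "finite C" "preorder_convex L s C"
      and unit: "\<And>D. finite D \<Longrightarrow> preorder_convex L s D \<Longrightarrow> C \<subseteq> D
        \<Longrightarrow> restrict A (D \<times> D) \<in> Units (mat_struct R D)"
      unfolding nonsingular_mat_def by blast
    have CL: "C \<subseteq> L" using C(2) by (simp add: preorder_convex_def)
    let ?K = "\<lambda>D. incidence_ring R D (s \<inter> D \<times> D)"
    let ?A = "\<lambda>D. restrict A (D \<times> D)"
    define Y where "Y D = inv\<^bsub>?K D\<^esub> (?A D)" for D
    have unit_K: "?A D \<in> Units (?K D)"
      if "finite D" "preorder_convex L s D" "C \<subseteq> D" for D
    proof -
      have DL: "D \<subseteq> L" using that by (simp add: preorder_convex_def)
      interpret D: incidence_cring R D "s \<inter> D \<times> D" using DL by (rule incidence_cring_restrict)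
      show ?thesis using that unit A DL by (intro D.triangular_inverse restrict_closed) auto
    qed
    \<comment> \<open>Only nested blocks are compared. The set \<open>D\<close> is also convex
      within \<open>D'\<close>, so \<open>restrict_inverse\<close> applies in the incidence ring of
      \<open>D'\<close>.\<close>
    have Y_entry: "Y D' (i, j) = Y D (i, j)"
      if D: "finite D" "preorder_convex L s D" "C \<subseteq> D" "i \<in> D" "j \<in> D"
        and D': "finite D'" "preorder_convex L s D'" "D \<subseteq> D'" for D D' i j
    proof -
      have DL: "D' \<subseteq> L" using D' by (simp add: preorder_convex_def)
      interpret D': incidence_cring R D' "s \<inter> D' \<times> D'" using DL by (rule incidence_cring_restrict)
      have "preorder_convex D' (s \<inter> D' \<times> D') D"
        using D(2) D'(3) DL unfolding preorder_convex_def preorder_interval_def by blast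
      then have "inv\<^bsub>incidence_ring R D ((s \<inter> D' \<times> D') \<inter> D \<times> D)\<^esub> (restrict (?A D') (D \<times> D))
          = restrict (Y D') (D \<times> D)"
        unfolding Y_def using D D' unit_K by (intro D'.restrict_inverse) auto
      moreover have "(s \<inter> D' \<times> D') \<inter> D \<times> D = s \<inter> D \<times> D" "D' \<times> D' \<inter> D \<times> D = D \<times> D"
        using D'(3) by auto
      ultimately have "Y D = restrict (Y D') (D \<times> D)"
        unfolding Y_def by (simp add: restrict_restrict)
      then show ?thesis using D by simp
    qed
    \<comment> \<open>The smallest admissible block containing \<open>i\<close> and
      \<open>j\<close>. It lies in every other such block, so an entry of \<open>X\<close> may be
      read off from any of them.\<close>
    define H where "H i j = interval_hull (C \<union> {i, j})" for i j
    have H: "finite (H i j)" "preorder_convex L s (H i j)" "C \<subseteq> H i j" "i \<in> H i j" "j \<in> H i j"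
      if "i \<in> L" "j \<in> L" for i j
      using interval_hull[of "C \<union> {i, j}"] C CL that by (auto simp: H_def)
    define X where "X = (\<lambda>(i, j)\<in>L \<times> L. Y (H i j) (i, j))"
    have X_entry: "X (i, j) = Y D (i, j)"
      if "finite D" "preorder_convex L s D" "C \<subseteq> D" "i \<in> D" "j \<in> D" for D i j
    proof -
      have ij: "i \<in> L" "j \<in> L" using that by (auto simp: preorder_convex_def)
      have "H i j \<subseteq> D" unfolding H_def using that ij CL by (intro interval_hull) auto
      then show ?thesis using Y_entry[OF H[OF ij] that(1,2)] ij by (simp add: X_def)
    qed
    have Y_closed: "Y D \<in> carrier (?K D)"
      and Y_mult: "mat_mult R D (?A D) (Y D) = mat_one R D" "mat_mult R D (Y D) (?A D) = mat_one R D"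
      if "finite D" "preorder_convex L s D" "C \<subseteq> D" for D
    proof -
      have DL: "D \<subseteq> L" using that by (simp add: preorder_convex_def)
      interpret D: incidence_cring R D "s \<inter> D \<times> D" using DL by (rule incidence_cring_restrict)
      interpret KD: ring "?K D" by (rule D.incidence_ring)
      show "Y D \<in> carrier (?K D)" "mat_mult R D (?A D) (Y D) = mat_one R D"
        "mat_mult R D (Y D) (?A D) = mat_one R D"
        unfolding Y_def using KD.Units_r_inv KD.Units_l_inv unit_K[OF that] by auto
    qed
    have X: "X \<in> carrier K"
      unfolding incidence_ring_carrier
    proof (intro conjI ballI impI PiE_I)
      fix x assume "x \<in> L \<times> L"
      then obtain i j where x: "x = (i, j)" and ij: "i \<in> L" "j \<in> L" by auto
      show "X x \<in> carrier R"
        using Y_closed[OF H(1-3)[OF ij]] H(4,5)[OF ij] ij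
        by (auto simp: x X_def incidence_ring_carrier PiE_iff)
    next
      fix i j assume "i \<in> L" "j \<in> L" "(i, j) \<notin> s"
      then show "X (i, j) = \<zero>"
        using Y_closed[OF H(1-3)] H(4,5) by (auto simp: X_def incidence_ring_carrier)
    qed (auto simp: X_def)
    \<comment> \<open>Both products can be tested on the block \<open>H i j\<close>, where
      \<open>X\<close> restricts to the inverse of the restriction of \<open>A\<close>.\<close>
    have eq: "mat_mult R L A X (i, j) = mat_one R L (i, j)"
      "mat_mult R L X A (i, j) = mat_one R L (i, j)" if ij: "i \<in> L" "j \<in> L" for i j
    proof -
      let ?D = "H i j"
      have DL: "?D \<subseteq> L" using H(2)[OF ij] by (simp add: preorder_convex_def)
      have XY: "restrict X (?D \<times> ?D) = Y ?D"
        using Y_closed[OF H(1-3)[OF ij]] X_entry[OF H(1-3)[OF ij]]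
        by (intro matrix_eqI[of _ ?D]) (auto simp: incidence_ring_carrier PiE_iff)
      have "restrict (mat_mult R L A X) (?D \<times> ?D) = restrict (mat_one R L) (?D \<times> ?D)"
        "restrict (mat_mult R L X A) (?D \<times> ?D) = restrict (mat_one R L) (?D \<times> ?D)"
        unfolding restrict_mult[OF A X H(2)[OF ij]] restrict_mult[OF X A H(2)[OF ij]] XY
          restrict_one[OF DL] by (intro Y_mult H ij)+
      then show "mat_mult R L A X (i, j) = mat_one R L (i, j)"
        "mat_mult R L X A (i, j) = mat_one R L (i, j)"
        using H(4,5)[OF ij] by (metis SigmaI restrict_apply')+
    qed
    have "mat_mult R L A X = mat_one R L" "mat_mult R L X A = mat_one R L"
      using eq by (auto intro!: matrix_eqI[of _ L] simp: mat_mult_def mat_one_def)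
    then show "A \<in> Units K" using A X unfolding Units_def by auto
  qed
qed

end

section \<open>The group of almost upper triangular matrices\<close>

lemma strongly_convex_imp_convex:
  assumes "strongly_convex L r C"
  shows "preorder_convex L r C"
  using assms unfolding strongly_convex_def preorder_convex_def preorder_interval_def preorder_less_def
  by blast

lemma preorder_adjoin_mono: "C \<subseteq> C' \<Longrightarrow> preorder_adjoin L r C \<subseteq> preorder_adjoin L r C'"
  unfolding preorder_adjoin_def by blast

section \<open>The enlarged preorders and their convex sets\<close>

text \<open>A chain that passes through \<open>C\<close> several times can jump from its first to
  its last element in \<open>C\<close>, so one passage suffices.\<close>

lemma preorder_adjoin_eq:
  assumes r: "preorder_on L r" and C: "C \<subseteq> L"
  shows "preorder_adjoin L r C = r \<union> {(i, j). \<exists>a\<in>C. \<exists>b\<in>C. (i, a) \<in> r \<and> (b, j) \<in> r}"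
    (is "_ = ?s")
proof
  have "preorder_on L ?s"
    using r unfolding preorder_on_def refl_on_def trans_def by blast
  moreover have "C \<times> C \<subseteq> ?s"
    using r C unfolding preorder_on_def refl_on_def by blast
  ultimately show "preorder_adjoin L r C \<subseteq> ?s" unfolding preorder_adjoin_def by blast
  show "?s \<subseteq> preorder_adjoin L r C"
    unfolding preorder_adjoin_def
  proof (intro subsetI InterI)
    fix x s assume x: "x \<in> ?s" and "s \<in> {s. preorder_on L s \<and> r \<subseteq> s \<and> C \<times> C \<subseteq> s}"
    then have s: "trans s" "r \<subseteq> s" "C \<times> C \<subseteq> s" by (auto simp: preorder_on_def)
    show "x \<in> s"
      using x
    proof
      assume "x \<in> {(i, j). \<exists>a\<in>C. \<exists>b\<in>C. (i, a) \<in> r \<and> (b, j) \<in> r}"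
      then obtain i j a b where "x = (i, j)" "(i, a) \<in> s" "(a, b) \<in> s" "(b, j) \<in> s"
        using s by blast
      then show ?thesis using s(1) by (auto dest: transD)
    qed (use s in blast)
  qed
qed

locale Z_like_cring = cring R for R (structure) +
  fixes L :: "'i set" and r :: "('i \<times> 'i) set"
  assumes preorder: "preorder_on L r" and Z_like: "Z_like L r"
begin

lemma finite_subset_convex:
  assumes "finite F" "F \<subseteq> L"
  obtains C where "finite C" "preorder_convex L r C" "F \<subseteq> C"
proof -
  obtain C where "finite C" "strongly_convex L r C" "F \<subseteq> C"
    using Z_like assms unfolding Z_like_def by meson
  then show ?thesis using that by (simp add: strongly_convex_imp_convex)
qed

abbreviation fin_convex :: "'i set \<Rightarrow> bool" where
  "fin_convex C \<equiv> finite C \<and> preorder_convex L r C"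

abbreviation adj :: "'i set \<Rightarrow> ('i \<times> 'i) set" where
  "adj \<equiv> preorder_adjoin L r"

abbreviation U :: "'i set \<Rightarrow> ('i \<times> 'i \<Rightarrow> 'a) set" where
  "U C \<equiv> U_set R L (adj C)"

abbreviation AU :: "('i \<times> 'i \<Rightarrow> 'a) set" where
  "AU \<equiv> AU_set R L r"

lemma fin_convex_subset: "fin_convex C \<Longrightarrow> C \<subseteq> L"
  by (simp add: preorder_convex_def)

lemma fin_convex_empty: "fin_convex {}"
  by (simp add: preorder_convex_def)

lemma r_subset_adj: "r \<subseteq> adj C"
  unfolding preorder_adjoin_def by blast

lemma adj_preorder:
  assumes "C \<subseteq> L"
  shows "preorder_on L (adj C)"
  using preorder assms unfolding preorder_adjoin_eq[OF preorder assms]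
  unfolding preorder_on_def refl_on_def trans_def by blast

text \<open>Here strong convexity is used beyond ordinary convexity. The finite square
  \<open>D \<times> D\<close> later gives finite intervals, the inclusion of \<open>U C\<close> in
  \<open>AU\<close>, and the openness of the groups in one another.\<close>

lemma adj_finite_extension:
  assumes C: "fin_convex C"
  obtains D where "finite D" "D \<subseteq> L" "adj C \<subseteq> r \<union> D \<times> D"
proof -
  have CL: "C \<subseteq> L" using C by (rule fin_convex_subset)
  then obtain D where D: "finite D" "strongly_convex L r D" "C \<subseteq> D"
    using Z_like C unfolding Z_like_def by meson
  have trans: "(i, j) \<in> r \<Longrightarrow> (j, k) \<in> r \<Longrightarrow> (i, k) \<in> r" for i j k
    using preorder unfolding preorder_on_def trans_def by blast
  have field: "i \<in> L" "j \<in> L" if "(i, j) \<in> r" for i j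
    using preorder that unfolding preorder_on_def by auto
  \<comment> \<open>An index outside \<open>D\<close> lies on one side of all of \<open>D\<close>, so its new relations are old ones.\<close>
  have "(i, j) \<in> r \<union> D \<times> D" if new: "a \<in> C" "b \<in> C" "(i, a) \<in> r" "(b, j) \<in> r" for i j a b
  proof (rule ccontr)
    assume *: "(i, j) \<notin> r \<union> D \<times> D"
    have ab: "a \<in> D" "b \<in> D" using new D by auto
    from * consider "i \<in> L - D" | "j \<in> L - D" using field[OF new(3)] field[OF new(4)] by blast
    then show False
    proof cases
      case 1
      then have "(i, b) \<in> r"
        using D(2) new(3) ab unfolding strongly_convex_def preorder_less_def by blast
      then show False using trans[of i b j] new * by blast
    next
      case 2
      then have "(a, j) \<in> r"
        using D(2) new(4) ab unfolding strongly_convex_def preorder_less_def by blast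
      then show False using trans[of i a j] new * by blast
    qed
  qed
  then have "adj C \<subseteq> r \<union> D \<times> D"
    unfolding preorder_adjoin_eq[OF preorder CL] by blast
  then show ?thesis using that D by (auto simp: strongly_convex_def)
qed

text \<open>An element between \<open>i\<close> and \<open>j\<close> for the enlarged preorder lies
  in the finite set \<open>D\<close> or was between them already.\<close>

lemma adj_incidence_cring:
  assumes C: "fin_convex C"
  shows "incidence_cring R L (adj C)"
proof unfold_locales
  show "preorder_on L (adj C)" using C by (intro adj_preorder fin_convex_subset)
  obtain D where D: "finite D" "D \<subseteq> L" "adj C \<subseteq> r \<union> D \<times> D"
    using C by (rule adj_finite_extension)
  show "finite (preorder_interval L (adj C) i j)" for i j
  proof -
    \<comment> \<open>The indices are arbitrary here; if one of them is outside \<open>L\<close>,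
      the interval is empty.\<close>
    obtain E where E: "fin_convex E" "{i, j} \<inter> L \<subseteq> E"
      using finite_subset_convex[of "{i, j} \<inter> L"] by blast
    have "preorder_interval L r i j \<subseteq> E"
      using E preorder unfolding preorder_convex_def preorder_interval_def preorder_on_def by blast
    moreover have "preorder_interval L (adj C) i j \<subseteq> D \<union> preorder_interval L r i j"
      using D(3) unfolding preorder_interval_def by blast
    ultimately show ?thesis using D(1) E(1) by (meson finite_UnI finite_subset)
  qed
qed

text \<open>A new relation passes through points of \<open>C\<close>, which belong to
  \<open>D\<close>. So an element between two points of \<open>D\<close> for the enlarged preorder
  is already between two, possibly different, points of \<open>D\<close> for
  \<open>r\<close>.\<close>

lemma convex_adj_iff:
  assumes "C \<subseteq> D" "C \<subseteq> L"
  shows "preorder_convex L (adj C) D \<longleftrightarrow> preorder_convex L r D"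
proof
  show "preorder_convex L (adj C) D \<Longrightarrow> preorder_convex L r D"
    using r_subset_adj[of C] unfolding preorder_convex_def preorder_interval_def by blast
  show "preorder_convex L r D \<Longrightarrow> preorder_convex L (adj C) D"
    using assms(1) unfolding preorder_adjoin_eq[OF preorder assms(2)]
    unfolding preorder_convex_def preorder_interval_def by blast
qed

text \<open>A threshold may be enlarged until it contains \<open>C\<close>, and beyond it both
  preorders have the same convex sets.\<close>

lemma nonsingular_adj_iff:
  assumes C: "fin_convex C"
  shows "nonsingular_mat R L (adj C) A \<longleftrightarrow> nonsingular_mat R L r A"
proof
  have CL: "C \<subseteq> L" using C by (rule fin_convex_subset)
  show "nonsingular_mat R L r A" if ns: "nonsingular_mat R L (adj C) A"
  proof -
    obtain E where E: "finite E" "preorder_convex L (adj C) E"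
      and unit: "\<And>D. finite D \<Longrightarrow> preorder_convex L (adj C) D \<Longrightarrow> E \<subseteq> D
        \<Longrightarrow> restrict A (D \<times> D) \<in> Units (mat_struct R D)"
      using ns unfolding nonsingular_mat_def by blast
    have "E \<subseteq> L" using E(2) by (simp add: preorder_convex_def)
    then obtain E' where "finite E'" "preorder_convex L r E'" "E \<union> C \<subseteq> E'"
      using finite_subset_convex[of "E \<union> C"] E C CL by auto
    moreover from this have "restrict A (D \<times> D) \<in> Units (mat_struct R D)"
      if "finite D" "preorder_convex L r D" "E' \<subseteq> D" for D
      using that CL by (intro unit) (auto simp: convex_adj_iff)
    ultimately show ?thesis unfolding nonsingular_mat_def by blast
  qed
  show "nonsingular_mat R L (adj C) A" if ns: "nonsingular_mat R L r A"
  proof -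
    obtain E where E: "finite E" "preorder_convex L r E"
      and unit: "\<And>D. finite D \<Longrightarrow> preorder_convex L r D \<Longrightarrow> E \<subseteq> D
        \<Longrightarrow> restrict A (D \<times> D) \<in> Units (mat_struct R D)"
      using ns unfolding nonsingular_mat_def by blast
    have "E \<subseteq> L" using E(2) by (simp add: preorder_convex_def)
    then obtain E' where E': "finite E'" "preorder_convex L r E'" "E \<union> C \<subseteq> E'"
      using finite_subset_convex[of "E \<union> C"] E C CL by auto
    then have "preorder_convex L (adj C) E'" using CL by (simp add: convex_adj_iff)
    moreover have "restrict A (D \<times> D) \<in> Units (mat_struct R D)"
      if "finite D" "preorder_convex L (adj C) D" "E' \<subseteq> D" for D
    proof -
      have "C \<subseteq> D" using that E' by auto
      then show ?thesis using that E' CL by (intro unit) (auto simp: convex_adj_iff)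
    qed
    ultimately show ?thesis using E' unfolding nonsingular_mat_def by blast
  qed
qed

section \<open>\<open>AU\<close> as a directed union of unit groups\<close>

text \<open>With nonsingularity expressed through \<open>r\<close> alone, the groups
  \<open>U C\<close> differ only in which entries must vanish.\<close>

lemma mem_U_iff:
  assumes C: "fin_convex C"
  shows "A \<in> U C \<longleftrightarrow> A \<in> L \<times> L \<rightarrow>\<^sub>E carrier R \<and> nonsingular_mat R L r A \<and>
    (\<forall>i\<in>L. \<forall>j\<in>L. (i, j) \<notin> adj C \<longrightarrow> A (i, j) = \<zero>)"
  by (simp add: U_set_def upper_triangular_mat_def nonsingular_adj_iff[OF C])

lemma U_mono:
  assumes "fin_convex C" "fin_convex C'" "C \<subseteq> C'"
  shows "U C \<subseteq> U C'"
  using preorder_adjoin_mono[OF assms(3), of L r]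
  unfolding subset_iff mem_U_iff[OF assms(1)] mem_U_iff[OF assms(2)] by blast

lemma U_subset_AU:
  assumes C: "fin_convex C"
  shows "U C \<subseteq> AU"
proof
  fix A assume A: "A \<in> U C"
  obtain D where D: "finite D" "D \<subseteq> L" "adj C \<subseteq> r \<union> D \<times> D"
    using C by (rule adj_finite_extension)
  have "{(i, j). i \<in> L \<and> j \<in> L \<and> (i, j) \<notin> r \<and> A (i, j) \<noteq> \<zero>} \<subseteq> D \<times> D"
    using A D(3) unfolding mem_U_iff[OF C] by blast
  then have "almost_upper_triangular_mat R L r A"
    unfolding almost_upper_triangular_mat_def using D(1) by (meson finite_SigmaI finite_subset)
  then show "A \<in> AU" using A by (simp add: AU_set_def mem_U_iff[OF C])
qed

text \<open>Any finite convex \<open>C\<close> containing the row and column indices of the finitely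
  many exceptional entries works, since \<open>adj C\<close> contains
  \<open>C \<times> C\<close>.\<close>

lemma AU_cases:
  assumes A: "A \<in> AU"
  obtains C where "fin_convex C" "A \<in> U C"
proof -
  let ?B = "{(i, j). i \<in> L \<and> j \<in> L \<and> (i, j) \<notin> r \<and> A (i, j) \<noteq> \<zero>}"
  have "finite ?B" using A by (simp add: AU_set_def almost_upper_triangular_mat_def)
  then obtain C where C: "finite C" "preorder_convex L r C" "fst ` ?B \<union> snd ` ?B \<subseteq> C"
    using finite_subset_convex[of "fst ` ?B \<union> snd ` ?B"] by (auto simp: image_subset_iff)
  have "A (i, j) = \<zero>" if "i \<in> L" "j \<in> L" "(i, j) \<notin> adj C" for i j
  proof (rule ccontr)
    assume "A (i, j) \<noteq> \<zero>"
    then have "(i, j) \<in> ?B" using that r_subset_adj[of C] by blast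
    then have "(i, j) \<in> C \<times> C" using C(3) by force
    then show False using that(3) unfolding preorder_adjoin_def by blast
  qed
  then have "A \<in> U C" using A C by (simp add: AU_set_def mem_U_iff)
  then show ?thesis using that C by blast
qed

lemma U_directed:
  assumes "fin_convex C" "fin_convex C'"
  obtains C'' where "fin_convex C''" "C \<subseteq> C''" "C' \<subseteq> C''" "U C \<subseteq> U C''" "U C' \<subseteq> U C''"
proof -
  obtain C'' where "finite C''" "preorder_convex L r C''" "C \<union> C' \<subseteq> C''"
    using finite_subset_convex[of "C \<union> C'"] assms fin_convex_subset by auto
  then have C'': "fin_convex C''" "C \<subseteq> C''" "C' \<subseteq> C''" by auto
  show ?thesis
    by (rule that[OF C'' U_mono[OF assms(1) C''(1,2)] U_mono[OF assms(2) C''(1,3)]])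
qed

lemma AU_cases2:
  assumes "A \<in> AU" "B \<in> AU"
  obtains C where "fin_convex C" "A \<in> U C" "B \<in> U C"
proof -
  obtain C where C: "fin_convex C" "A \<in> U C" using assms(1) by (rule AU_cases)
  obtain C' where C': "fin_convex C'" "B \<in> U C'" using assms(2) by (rule AU_cases)
  obtain C'' where "fin_convex C''" "U C \<subseteq> U C''" "U C' \<subseteq> U C''"
    using C(1) C'(1) by (rule U_directed)
  then show ?thesis using that C(2) C'(2) by blast
qed

lemma U_eq_Units: "fin_convex C \<Longrightarrow> U C = Units (incidence_ring R L (adj C))"
  using adj_incidence_cring incidence_cring.U_set_eq_Units by blast

lemma incidence_monoid: "fin_convex C \<Longrightarrow> monoid (incidence_ring R L (adj C))"
  using adj_incidence_cring incidence_cring.incidence_ring ring.is_monoid by blast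

lemma U_mult_closed:
  assumes C: "fin_convex C" and "A \<in> U C" "B \<in> U C"
  shows "mat_mult R L A B \<in> U C"
  using assms monoid.Units_m_closed[OF incidence_monoid[OF C], of A B] by (simp add: U_eq_Units[OF C])

lemma AU_group_simps [simp]:
  "carrier (AU_group R L r) = AU"
  "monoid.mult (AU_group R L r) = mat_mult R L"
  "one (AU_group R L r) = mat_one R L"
  by (simp_all add: AU_group_def mat_struct_def)

lemma U_inv:
  assumes C: "fin_convex C" and A: "A \<in> U C"
  defines "B \<equiv> inv\<^bsub>incidence_ring R L (adj C)\<^esub> A"
  shows "B \<in> U C" "mat_mult R L B A = mat_one R L"
proof -
  let ?K = "incidence_ring R L (adj C)"
  interpret K: monoid ?K using C by (rule incidence_monoid)
  have A': "A \<in> Units ?K" using A by (simp add: U_eq_Units[OF C])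
  show "B \<in> U C" unfolding B_def U_eq_Units[OF C] using A' by (rule K.Units_inv_Units)
  show "mat_mult R L B A = mat_one R L"
    using K.Units_l_inv[OF A'] by (simp add: B_def)
qed

text \<open>Each law involves finitely many matrices, which lie in a common \<open>U C\<close>.
  There the product is that of an incidence ring, so the default value of \<open>mat_mult\<close>
  for infinite sums does not interfere.\<close>

lemma AU_group: "group (AU_group R L r)"
proof (rule groupI; unfold AU_group_simps)
  fix A B assume A: "A \<in> AU" and B: "B \<in> AU"
  then obtain C where C: "fin_convex C" "A \<in> U C" "B \<in> U C" by (rule AU_cases2)
  show "mat_mult R L A B \<in> AU" using U_mult_closed[OF C] U_subset_AU[OF C(1)] by blast
  fix X assume "X \<in> AU"
  then obtain C' where C': "fin_convex C'" "X \<in> U C'" by (rule AU_cases)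
  obtain E where E: "fin_convex E" "U C \<subseteq> U E" "U C' \<subseteq> U E" using C(1) C'(1) by (rule U_directed)
  interpret K: monoid "incidence_ring R L (adj E)" using E(1) by (rule incidence_monoid)
  have "A \<in> Units (incidence_ring R L (adj E))" "B \<in> Units (incidence_ring R L (adj E))"
    "X \<in> Units (incidence_ring R L (adj E))"
    using C C' E by (auto simp: U_eq_Units[symmetric])
  then show "mat_mult R L (mat_mult R L A B) X = mat_mult R L A (mat_mult R L B X)"
    using K.m_assoc[of A B X] by auto
next
  interpret K: monoid "incidence_ring R L (adj {})" using fin_convex_empty by (rule incidence_monoid)
  show "mat_one R L \<in> AU"
    using K.Units_one_closed U_subset_AU[OF fin_convex_empty] U_eq_Units[OF fin_convex_empty] by auto
next
  fix A assume "A \<in> AU"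
  then obtain C where C: "fin_convex C" "A \<in> U C" by (rule AU_cases)
  interpret K: monoid "incidence_ring R L (adj C)" using C(1) by (rule incidence_monoid)
  have "A \<in> Units (incidence_ring R L (adj C))" using C by (simp add: U_eq_Units)
  then show "mat_mult R L (mat_one R L) A = A" using K.l_one[of A] by auto
  show "\<exists>B\<in>AU. mat_mult R L B A = mat_one R L"
    using U_inv[OF C] U_subset_AU[OF C(1)] by blast
qed

text \<open>In particular the inverse does not depend on the choice of \<open>C\<close>, and
  inversion on all of \<open>U C\<close> can be studied in a single incidence ring.\<close>

lemma AU_inv:
  assumes C: "fin_convex C" and A: "A \<in> U C"
  shows "inv\<^bsub>AU_group R L r\<^esub> A = inv\<^bsub>incidence_ring R L (adj C)\<^esub> A"
  using U_inv[OF C A] U_subset_AU[OF C] A by (intro group.inv_equality[OF AU_group]) auto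

end

section \<open>The topology\<close>

text \<open>As the factors are discrete, a basic neighbourhood can be shrunk to one that fixes
  finitely many entries. All topological arguments become statements about dependence on finitely
  many entries.\<close>

lemma openin_mat_topology:
  "openin (mat_topology R L) W \<longleftrightarrow> W \<subseteq> L \<times> L \<rightarrow>\<^sub>E carrier R \<and>
     (\<forall>A\<in>W. \<exists>F. finite F \<and> F \<subseteq> L \<times> L \<and>
        (\<forall>B\<in>L \<times> L \<rightarrow>\<^sub>E carrier R. (\<forall>x\<in>F. B x = A x) \<longrightarrow> B \<in> W))"
    (is "?l \<longleftrightarrow> ?r")
proof
  assume ?l
  then have sub: "W \<subseteq> L \<times> L \<rightarrow>\<^sub>E carrier R"
    using openin_subset[of "mat_topology R L" W] by (simp add: mat_topology_def)
  have dep: "\<exists>F. finite F \<and> F \<subseteq> L \<times> L \<and>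
      (\<forall>B\<in>L \<times> L \<rightarrow>\<^sub>E carrier R. (\<forall>x\<in>F. B x = A x) \<longrightarrow> B \<in> W)" if A: "A \<in> W" for A
  proof -
    obtain V where V: "finite {x \<in> L \<times> L. V x \<noteq> carrier R}" "A \<in> Pi\<^sub>E (L \<times> L) V"
      "Pi\<^sub>E (L \<times> L) V \<subseteq> W"
      using \<open>?l\<close> A unfolding mat_topology_def openin_product_topology_alt by auto
    have "B \<in> W" if B: "B \<in> L \<times> L \<rightarrow>\<^sub>E carrier R"
      and eq: "\<forall>x\<in>{x \<in> L \<times> L. V x \<noteq> carrier R}. B x = A x" for B
    proof -
      have "B x \<in> V x" if "x \<in> L \<times> L" for x
      proof (cases "V x = carrier R")
        case True
        then show ?thesis using PiE_mem[OF B that] by simp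
      next
        case False
        then have "B x = A x" using eq that by blast
        then show ?thesis using PiE_mem[OF V(2) that] by simp
      qed
      then have "B \<in> Pi\<^sub>E (L \<times> L) V" using B by (auto simp: PiE_iff)
      then show ?thesis using V(3) by blast
    qed
    then show ?thesis using V(1) by (intro exI[of _ "{x \<in> L \<times> L. V x \<noteq> carrier R}"]) auto
  qed
  show ?r by (intro conjI ballI sub dep)
next
  assume r: ?r
  show ?l
    unfolding mat_topology_def openin_product_topology_alt
  proof
    fix A assume A: "A \<in> W"
    then obtain F where F: "finite F" "F \<subseteq> L \<times> L"
      "\<And>B. B \<in> L \<times> L \<rightarrow>\<^sub>E carrier R \<Longrightarrow> \<forall>x\<in>F. B x = A x \<Longrightarrow> B \<in> W"
      using r by meson
    have AM: "A \<in> L \<times> L \<rightarrow>\<^sub>E carrier R" using A r by blast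
    let ?V = "\<lambda>x. if x \<in> F then {A x} else carrier R"
    have Vsub: "?V x \<subseteq> carrier R" if "x \<in> L \<times> L" for x using AM that by auto
    have "finite {x \<in> L \<times> L. ?V x \<noteq> topspace (discrete_topology (carrier R))}"
      by (rule finite_subset[OF _ F(1)]) auto
    moreover have "\<forall>x\<in>L \<times> L. openin (discrete_topology (carrier R)) (?V x)"
      using Vsub by (simp add: openin_discrete_topology)
    moreover have "A \<in> Pi\<^sub>E (L \<times> L) ?V" using AM by (auto simp: PiE_iff)
    moreover have "Pi\<^sub>E (L \<times> L) ?V \<subseteq> W"
    proof
      fix B assume B: "B \<in> Pi\<^sub>E (L \<times> L) ?V"
      have "B \<in> L \<times> L \<rightarrow>\<^sub>E carrier R"
        using subsetD[OF PiE_mono B, of "\<lambda>_. carrier R"] Vsub by simp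
      moreover have "\<forall>x\<in>F. B x = A x"
      proof
        fix x assume "x \<in> F"
        then show "B x = A x" using PiE_mem[OF B, of x] F(2) by auto
      qed
      ultimately show "B \<in> W" by (rule F(3))
    qed
    ultimately show "\<exists>V. finite {x \<in> L \<times> L. V x \<noteq> topspace (discrete_topology (carrier R))} \<and>
        (\<forall>x\<in>L \<times> L. openin (discrete_topology (carrier R)) (V x)) \<and>
        A \<in> Pi\<^sub>E (L \<times> L) V \<and> Pi\<^sub>E (L \<times> L) V \<subseteq> W"
      by (intro exI[of _ ?V] conjI)
  qed
qed

lemma topspace_mat_topology [simp]: "topspace (mat_topology R L) = L \<times> L \<rightarrow>\<^sub>E carrier R"
  by (simp add: mat_topology_def)

lemma U_set_subset: "U_set R L s \<subseteq> L \<times> L \<rightarrow>\<^sub>E carrier R"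
  by (auto simp: U_set_def)

lemma topspace_U_topology [simp]: "topspace (U_topology R L s) = U_set R L s"
  using U_set_subset[of R L s] by (auto simp: U_topology_def)

lemma openin_U_topology:
  "openin (U_topology R L s) V \<longleftrightarrow> V \<subseteq> U_set R L s \<and>
     (\<forall>A\<in>V. \<exists>F. finite F \<and> F \<subseteq> L \<times> L \<and>
        (\<forall>B\<in>U_set R L s. (\<forall>x\<in>F. B x = A x) \<longrightarrow> B \<in> V))"
    (is "?l \<longleftrightarrow> ?r")
proof
  assume ?l
  then obtain W where W: "openin (mat_topology R L) W" "V = W \<inter> U_set R L s"
    by (auto simp: U_topology_def openin_subtopology)
  have dep: "\<exists>F. finite F \<and> F \<subseteq> L \<times> L \<and> (\<forall>B\<in>U_set R L s. (\<forall>x\<in>F. B x = A x) \<longrightarrow> B \<in> V)"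
    if A: "A \<in> V" for A
  proof -
    obtain F where F: "finite F" "F \<subseteq> L \<times> L"
      "\<forall>B\<in>L \<times> L \<rightarrow>\<^sub>E carrier R. (\<forall>x\<in>F. B x = A x) \<longrightarrow> B \<in> W"
      using W A unfolding openin_mat_topology by blast
    have "B \<in> V" if "B \<in> U_set R L s" "\<forall>x\<in>F. B x = A x" for B
      using that F(3) W(2) subsetD[OF U_set_subset that(1)] by blast
    then show ?thesis using F(1,2) by (intro exI[of _ F]) simp
  qed
  have "V \<subseteq> U_set R L s" using W(2) by blast
  then show ?r by (intro conjI ballI dep)
next
  assume r: ?r
  \<comment> \<open>The largest open set of matrices whose intersection with
    \<open>U_set R L s\<close> is contained in \<open>V\<close>.\<close>
  define W where "W = {B \<in> L \<times> L \<rightarrow>\<^sub>E carrier R. \<exists>F. finite F \<and> F \<subseteq> L \<times> L \<and>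
    (\<forall>X\<in>U_set R L s. (\<forall>x\<in>F. X x = B x) \<longrightarrow> X \<in> V)}"
  have "openin (mat_topology R L) W"
    unfolding openin_mat_topology
  proof (intro conjI ballI)
    fix A assume "A \<in> W"
    then obtain F where F: "finite F" "F \<subseteq> L \<times> L"
      "\<forall>X\<in>U_set R L s. (\<forall>x\<in>F. X x = A x) \<longrightarrow> X \<in> V" by (auto simp: W_def)
    have "B \<in> W" if B: "B \<in> L \<times> L \<rightarrow>\<^sub>E carrier R" "\<forall>x\<in>F. B x = A x" for B
      unfolding W_def using B F by (intro CollectI conjI exI[of _ F]) auto
    then show "\<exists>F. finite F \<and> F \<subseteq> L \<times> L \<and>
        (\<forall>B\<in>L \<times> L \<rightarrow>\<^sub>E carrier R. (\<forall>x\<in>F. B x = A x) \<longrightarrow> B \<in> W)"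
      using F(1,2) by (intro exI[of _ F]) simp
  qed (auto simp: W_def)
  moreover have "V = W \<inter> U_set R L s"
  proof
    show "V \<subseteq> W \<inter> U_set R L s"
    proof
      fix A assume A: "A \<in> V"
      then have "A \<in> U_set R L s" using r by blast
      moreover from this have "A \<in> W"
        unfolding W_def using r A subsetD[OF U_set_subset] by simp
      ultimately show "A \<in> W \<inter> U_set R L s" by simp
    qed
    show "W \<inter> U_set R L s \<subseteq> V" unfolding W_def by blast
  qed
  ultimately show ?l by (auto simp: U_topology_def openin_subtopology)
qed

section \<open>Finite dependence of products and inverses, and closedness\<close>

context incidence_cring
begin

text \<open>For each \<open>(i, j)\<close> in \<open>F\<close> it is enough to fix the factors in
  row \<open>i\<close> and column \<open>j\<close> along the interval from \<open>i\<close> to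
  \<open>j\<close>. The interval is that of \<open>s\<close>, so the perturbed matrices must stay in
  the same incidence ring.\<close>

lemma mult_finite_dependence:
  assumes A: "A \<in> carrier K" and B: "B \<in> carrier K" and F: "finite F" "F \<subseteq> L \<times> L"
  obtains G where "finite G" "G \<subseteq> L \<times> L"
    "\<And>A' B'. A' \<in> carrier K \<Longrightarrow> B' \<in> carrier K \<Longrightarrow> \<forall>x\<in>G. A' x = A x \<Longrightarrow> \<forall>x\<in>G. B' x = B x
      \<Longrightarrow> \<forall>x\<in>F. mat_mult R L A' B' x = mat_mult R L A B x"
proof
  let ?G = "\<Union>(i, j)\<in>F. \<Union>k\<in>preorder_interval L s i j. {(i, k), (k, j)}"
  show "finite ?G" using F(1) finite_interval by auto
  show "?G \<subseteq> L \<times> L" using F(2) interval_subset by (auto simp: subset_iff)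
  fix A' B'
  assume A': "A' \<in> carrier K" and B': "B' \<in> carrier K"
    and eqA: "\<forall>x\<in>?G. A' x = A x" and eqB: "\<forall>x\<in>?G. B' x = B x"
  show "\<forall>x\<in>F. mat_mult R L A' B' x = mat_mult R L A B x"
  proof
    fix x assume x: "x \<in> F"
    obtain i j where ij: "x = (i, j)" by (cases x)
    have ijL: "i \<in> L" "j \<in> L" using x F(2) ij by auto
    have G: "(i, k) \<in> ?G" "(k, j) \<in> ?G" if "k \<in> preorder_interval L s i j" for k
      using x that unfolding ij by blast+
    have "mat_mult R L A' B' (i, j)
        = (\<Oplus>k\<in>preorder_interval L s i j. A' (i, k) \<otimes> B' (k, j))"
      by (rule mult_entry_interval[OF A' B' ijL])
    also have "\<dots> = (\<Oplus>k\<in>preorder_interval L s i j. A (i, k) \<otimes> B (k, j))"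
    proof (intro finsum_cong' refl funcsetI)
      fix k assume k: "k \<in> preorder_interval L s i j"
      then have "k \<in> L" using interval_subset by blast
      then show "A (i, k) \<otimes> B (k, j) \<in> carrier R"
        using ijL by (intro m_closed incidenceD(3)[OF A] incidenceD(3)[OF B])
      show "A' (i, k) \<otimes> B' (k, j) = A (i, k) \<otimes> B (k, j)"
        using bspec[OF eqA G(1)[OF k]] bspec[OF eqB G(2)[OF k]] by simp
    qed
    also have "\<dots> = mat_mult R L A B (i, j)"
      by (rule mult_entry_interval[OF A B ijL, symmetric])
    finally show "mat_mult R L A' B' x = mat_mult R L A B x" by (simp add: ij)
  qed
qed

text \<open>
  By \<open>restrict_inverse\<close>, an entry of the inverse is an entry of the inverse of a finite
  convex block.
\<close>

lemma inverse_finite_dependence: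
  assumes A: "A \<in> Units K" and F: "finite F" "F \<subseteq> L \<times> L"
  obtains G where "finite G" "G \<subseteq> L \<times> L"
    "\<And>A'. A' \<in> Units K \<Longrightarrow> \<forall>x\<in>G. A' x = A x \<Longrightarrow> \<forall>x\<in>F. (inv\<^bsub>K\<^esub> A') x = (inv\<^bsub>K\<^esub> A) x"
proof
  let ?D = "interval_hull (fst ` F \<union> snd ` F)"
  let ?KD = "incidence_ring R ?D (s \<inter> ?D \<times> ?D)"
  have FL: "fst ` F \<union> snd ` F \<subseteq> L" using F(2) by auto
  have D: "preorder_convex L s ?D" using FL by (rule interval_hull)
  show "finite (?D \<times> ?D)" using F(1) interval_hull(2)[OF FL] by simp
  show "?D \<times> ?D \<subseteq> L \<times> L" using D by (auto simp: preorder_convex_def)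
  fix A' assume A': "A' \<in> Units K" and eq: "\<forall>x\<in>?D \<times> ?D. A' x = A x"
  have "restrict A' (?D \<times> ?D) = restrict A (?D \<times> ?D)" using eq by (intro restrict_ext) blast
  then have inv_eq: "restrict (inv\<^bsub>K\<^esub> A') (?D \<times> ?D) = restrict (inv\<^bsub>K\<^esub> A) (?D \<times> ?D)"
    using restrict_inverse(2)[OF A D] restrict_inverse(2)[OF A' D] by argo
  show "\<forall>x\<in>F. (inv\<^bsub>K\<^esub> A') x = (inv\<^bsub>K\<^esub> A) x"
  proof
    fix x assume "x \<in> F"
    then have "fst x \<in> ?D" "snd x \<in> ?D" using interval_hull(1)[OF FL] by auto
    then have "x \<in> ?D \<times> ?D" by (simp add: mem_Times_iff)
    then show "(inv\<^bsub>K\<^esub> A') x = (inv\<^bsub>K\<^esub> A) x" using inv_eq by (metis restrict_apply')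
  qed
qed

text \<open>Leaving \<open>U_set\<close> is visible in finitely many entries: either one forbidden
  entry is nonzero, or one finite convex block is singular. That one singular block is enough rests
  on \<open>U_set_eq_Units\<close>.\<close>

lemma closedin_U_set: "closedin (mat_topology R L) (U_set R L s)"
  unfolding closedin_def
proof (intro conjI)
  show "U_set R L s \<subseteq> topspace (mat_topology R L)" using U_set_subset by simp
  show "openin (mat_topology R L) (topspace (mat_topology R L) - U_set R L s)"
    unfolding openin_mat_topology
  proof (intro conjI ballI)
    fix A assume "A \<in> topspace (mat_topology R L) - U_set R L s"
    then have AM: "A \<in> L \<times> L \<rightarrow>\<^sub>E carrier R" and AU: "A \<notin> U_set R L s" by auto
    show "\<exists>F. finite F \<and> F \<subseteq> L \<times> L \<and> (\<forall>B\<in>L \<times> L \<rightarrow>\<^sub>E carrier R. (\<forall>x\<in>F. B x = A x)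
        \<longrightarrow> B \<in> topspace (mat_topology R L) - U_set R L s)"
    proof (cases "upper_triangular_mat R L s A")
      case False
      then obtain i j where ij: "i \<in> L" "j \<in> L" "(i, j) \<notin> s" "A (i, j) \<noteq> \<zero>"
        by (auto simp: upper_triangular_mat_def)
      then have "B \<notin> U_set R L s" if "\<forall>x\<in>{(i, j)}. B x = A x" for B
        using that unfolding U_set_def upper_triangular_mat_def by force
      then show ?thesis using ij by (intro exI[of _ "{(i, j)}"]) auto
    next
      case True
      \<comment> \<open>Failure of nonsingularity for the empty threshold produces the singular
        block \<open>D\<close>.\<close>
      then have "\<not> nonsingular_mat R L s A" using AM AU by (simp add: U_set_def)
      moreover have "finite ({} :: 'i set)" "preorder_convex L s {}" by (auto simp: preorder_convex_def)
      ultimately obtain D where D: "finite D" "preorder_convex L s D"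
        "restrict A (D \<times> D) \<notin> Units (mat_struct R D)"
        unfolding nonsingular_mat_def by blast
      have "B \<notin> U_set R L s" if "\<forall>x\<in>D \<times> D. B x = A x" for B
      proof
        assume "B \<in> U_set R L s"
        then have "restrict B (D \<times> D) \<in> Units (mat_struct R D)"
          using D(1,2) by (simp add: U_set_eq_Units Units_nonsingular_restrict)
        moreover have "restrict B (D \<times> D) = restrict A (D \<times> D)"
          using that by (intro restrict_ext) blast
        ultimately show False using D(3) by argo
      qed
      then show ?thesis using D by (intro exI[of _ "D \<times> D"]) (auto simp: preorder_convex_def)
    qed
  qed auto
qed

end

section \<open>The final topology on \<open>AU\<close>\<close>

context Z_like_cring
begin

definition T :: "('i \<times> 'i \<Rightarrow> 'a) topology" where
  "T = topology (\<lambda>W. W \<subseteq> AU \<and>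
     (\<forall>C. fin_convex C \<longrightarrow> openin (U_topology R L (adj C)) (W \<inter> U C)))"

lemma openin_T:
  "openin T W \<longleftrightarrow> W \<subseteq> AU \<and> (\<forall>C. fin_convex C \<longrightarrow> openin (U_topology R L (adj C)) (W \<inter> U C))"
proof -
  have "istopology (\<lambda>W. W \<subseteq> AU \<and>
     (\<forall>C. fin_convex C \<longrightarrow> openin (U_topology R L (adj C)) (W \<inter> U C)))"
    unfolding istopology_def
  proof (rule conjI; intro allI impI conjI)
    fix S S' C
    assume "S \<subseteq> AU \<and> (\<forall>C. fin_convex C \<longrightarrow> openin (U_topology R L (adj C)) (S \<inter> U C))"
      "S' \<subseteq> AU \<and> (\<forall>C. fin_convex C \<longrightarrow> openin (U_topology R L (adj C)) (S' \<inter> U C))"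
      "fin_convex C"
    then have "openin (U_topology R L (adj C)) ((S \<inter> U C) \<inter> (S' \<inter> U C))"
      by (intro openin_Int[of _ "S \<inter> U C" "S' \<inter> U C"]) auto
    moreover have "(S \<inter> U C) \<inter> (S' \<inter> U C) = S \<inter> S' \<inter> U C" by blast
    ultimately show "openin (U_topology R L (adj C)) (S \<inter> S' \<inter> U C)" by argo
  next
    fix \<W> C
    assume "\<forall>W\<in>\<W>. W \<subseteq> AU \<and> (\<forall>C. fin_convex C \<longrightarrow> openin (U_topology R L (adj C)) (W \<inter> U C))"
      "fin_convex C"
    then have "openin (U_topology R L (adj C)) (\<Union>W\<in>\<W>. W \<inter> U C)"
      by (intro openin_Union) auto
    moreover have "(\<Union>W\<in>\<W>. W \<inter> U C) = \<Union>\<W> \<inter> U C" by blast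
    ultimately show "openin (U_topology R L (adj C)) (\<Union>\<W> \<inter> U C)" by argo
  qed auto
  then show ?thesis unfolding T_def by simp
qed

text \<open>The point is that \<open>U C\<close> is open in \<open>U E\<close>. A matrix of
  \<open>U E\<close> can fail to be in \<open>U C\<close> only at positions of \<open>adj E\<close>
  outside \<open>adj C\<close>; these lie in the finite square \<open>D \<times> D\<close>, where it
  can be forced to agree with \<open>A\<close>.\<close>

lemma openin_U_imp_openin_T:
  assumes C: "fin_convex C" and V: "openin (U_topology R L (adj C)) V"
  shows "openin T V"
  unfolding openin_T
proof (intro conjI allI impI)
  have VU: "V \<subseteq> U C" using openin_subset[OF V] by simp
  then show "V \<subseteq> AU" using U_subset_AU[OF C] by blast
  fix C' assume C': "fin_convex C'"
  obtain E where E: "fin_convex E" "C \<subseteq> E" "C' \<subseteq> E" "U C \<subseteq> U E" "U C' \<subseteq> U E"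
    using C C' by (rule U_directed)
  obtain D where D: "finite D" "D \<subseteq> L" "adj E \<subseteq> r \<union> D \<times> D"
    using E(1) by (rule adj_finite_extension)
  show "openin (U_topology R L (adj C')) (V \<inter> U C')"
    unfolding openin_U_topology
  proof (intro conjI ballI)
    fix A assume A: "A \<in> V \<inter> U C'"
    obtain F where F: "finite F" "F \<subseteq> L \<times> L" "\<forall>B\<in>U C. (\<forall>x\<in>F. B x = A x) \<longrightarrow> B \<in> V"
      using V A unfolding openin_U_topology by blast
    \<comment> \<open>Agreement on \<open>D \<times> D\<close> keeps \<open>B\<close> in
      \<open>U C\<close>; agreement on \<open>F\<close> then keeps it in \<open>V\<close>.\<close>
    have "B \<in> V \<inter> U C'" if B: "B \<in> U C'" and eq: "\<forall>x\<in>F \<union> D \<times> D. B x = A x" for B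
    proof -
      have AC: "A \<in> U C" using A VU by blast
      have "B \<in> U E" using B E by blast
      have "B (i, j) = \<zero>" if ij: "i \<in> L" "j \<in> L" "(i, j) \<notin> adj C" for i j
      proof (cases "(i, j) \<in> adj E")
        case True
        then have "(i, j) \<in> D \<times> D" using D(3) ij(3) r_subset_adj[of C] by blast
        then have "B (i, j) = A (i, j)" using eq by blast
        then show ?thesis using AC ij unfolding mem_U_iff[OF C] by metis
      next
        case False
        then show ?thesis using \<open>B \<in> U E\<close> ij unfolding mem_U_iff[OF E(1)] by blast
      qed
      then have "B \<in> U C" using B unfolding mem_U_iff[OF C] mem_U_iff[OF C'] by blast
      then show ?thesis using F(3) B eq by blast
    qed
    then show "\<exists>F. finite F \<and> F \<subseteq> L \<times> L \<and>
        (\<forall>B\<in>U C'. (\<forall>x\<in>F. B x = A x) \<longrightarrow> B \<in> V \<inter> U C')"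
      using F D by (intro exI[of _ "F \<union> D \<times> D"]) auto
  qed auto
qed

lemma openin_T_U: "fin_convex C \<Longrightarrow> openin T (U C)"
  by (metis openin_U_imp_openin_T openin_topspace topspace_U_topology)

lemma topspace_T [simp]: "topspace T = AU"
proof
  show "topspace T \<subseteq> AU" using openin_topspace[of T] unfolding openin_T by simp
  show "AU \<subseteq> topspace T"
  proof
    fix A assume "A \<in> AU"
    then obtain C where C: "fin_convex C" "A \<in> U C" by (rule AU_cases)
    show "A \<in> topspace T" using openin_subset[OF openin_T_U[OF C(1)]] C(2) by blast
  qed
qed

lemma neighbourhood_T:
  assumes C: "fin_convex C" and A: "A \<in> U C" and F: "finite F" "F \<subseteq> L \<times> L"
  shows "openin T {B \<in> U C. \<forall>x\<in>F. B x = A x}"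
proof (rule openin_U_imp_openin_T[OF C])
  show "openin (U_topology R L (adj C)) {B \<in> U C. \<forall>x\<in>F. B x = A x}"
    unfolding openin_U_topology
  proof (intro conjI ballI)
    fix X assume "X \<in> {B \<in> U C. \<forall>x\<in>F. B x = A x}"
    then show "\<exists>F'. finite F' \<and> F' \<subseteq> L \<times> L \<and> (\<forall>B\<in>U C. (\<forall>x\<in>F'. B x = X x)
        \<longrightarrow> B \<in> {B \<in> U C. \<forall>x\<in>F. B x = A x})"
      using F by (intro exI[of _ F]) auto
  qed auto
qed

lemma T_finite_dependence:
  assumes W: "openin T W" and C: "fin_convex C" and A: "A \<in> W" "A \<in> U C"
  obtains F where "finite F" "F \<subseteq> L \<times> L" "\<And>B. B \<in> U C \<Longrightarrow> \<forall>x\<in>F. B x = A x \<Longrightarrow> B \<in> W"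
proof -
  have "openin (U_topology R L (adj C)) (W \<inter> U C)" using W C by (simp add: openin_T)
  then obtain F where "finite F" "F \<subseteq> L \<times> L" "\<forall>B\<in>U C. (\<forall>x\<in>F. B x = A x) \<longrightarrow> B \<in> W \<inter> U C"
    using A unfolding openin_U_topology by blast
  then show ?thesis using that by blast
qed

lemma U_carrier: "fin_convex C \<Longrightarrow> A \<in> U C \<Longrightarrow> A \<in> carrier (incidence_ring R L (adj C))"
  by (simp add: U_eq_Units Units_def)

text \<open>Continuity is local, and \<open>U C\<close> is an open set containing both factors, so
  it is checked within one incidence ring.\<close>

lemma continuous_mult_T:
  "continuous_map (prod_topology T T) T (\<lambda>(A, B). A \<otimes>\<^bsub>AU_group R L r\<^esub> B)"
  unfolding continuous_map_def
proof (intro conjI allI impI)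
  show "(\<lambda>(A, B). A \<otimes>\<^bsub>AU_group R L r\<^esub> B) \<in> topspace (prod_topology T T) \<rightarrow> topspace T"
    using AU_group monoid.m_closed[OF group.is_monoid[OF AU_group]] by auto
  fix W assume W: "openin T W"
  let ?V = "{x \<in> topspace (prod_topology T T). (case x of (A, B) \<Rightarrow> A \<otimes>\<^bsub>AU_group R L r\<^esub> B) \<in> W}"
  show "openin (prod_topology T T) ?V"
    unfolding openin_prod_topology_alt
  proof (intro allI impI)
    fix A B assume "(A, B) \<in> ?V"
    then have AU: "A \<in> AU" "B \<in> AU" and ABW: "mat_mult R L A B \<in> W" by auto
    obtain C where C: "fin_convex C" "A \<in> U C" "B \<in> U C" using AU by (rule AU_cases2)
    interpret incidence_cring R L "adj C" using C(1) by (rule adj_incidence_cring)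
    obtain F where F: "finite F" "F \<subseteq> L \<times> L"
      "\<And>X. X \<in> U C \<Longrightarrow> \<forall>x\<in>F. X x = mat_mult R L A B x \<Longrightarrow> X \<in> W"
      using T_finite_dependence[OF W C(1) ABW U_mult_closed[OF C]] by blast
    obtain G where G: "finite G" "G \<subseteq> L \<times> L"
      and dep: "\<And>A' B'. A' \<in> carrier K \<Longrightarrow> B' \<in> carrier K \<Longrightarrow> \<forall>x\<in>G. A' x = A x \<Longrightarrow> \<forall>x\<in>G. B' x = B x
        \<Longrightarrow> \<forall>x\<in>F. mat_mult R L A' B' x = mat_mult R L A B x"
      using mult_finite_dependence[OF U_carrier[OF C(1,2)] U_carrier[OF C(1,3)] F(1,2)] by blast
    let ?V1 = "{X \<in> U C. \<forall>x\<in>G. X x = A x}" and ?V2 = "{X \<in> U C. \<forall>x\<in>G. X x = B x}"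
    have "mat_mult R L A' B' \<in> W" if "A' \<in> ?V1" "B' \<in> ?V2" for A' B'
      using that dep U_carrier[OF C(1)] U_mult_closed[OF C(1)] by (intro F(3)) auto
    then have "?V1 \<times> ?V2 \<subseteq> ?V" using U_subset_AU[OF C(1)] by auto
    then show "\<exists>V1 V2. openin T V1 \<and> openin T V2 \<and> A \<in> V1 \<and> B \<in> V2 \<and> V1 \<times> V2 \<subseteq> ?V"
      using neighbourhood_T[OF C(1,2) G] neighbourhood_T[OF C(1,3) G] C
      by (intro exI[of _ ?V1] exI[of _ ?V2]) auto
  qed
qed

text \<open>Near \<open>A\<close> everything happens in the open set \<open>U C\<close>, on which
  \<open>AU_inv\<close> turns the group inverse into the inverse of one incidence ring.\<close>

lemma continuous_inv_T: "continuous_map T T (\<lambda>A. inv\<^bsub>AU_group R L r\<^esub> A)"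
  unfolding continuous_map_def
proof (intro conjI allI impI)
  show "(\<lambda>A. inv\<^bsub>AU_group R L r\<^esub> A) \<in> topspace T \<rightarrow> topspace T"
    using group.inv_closed[OF AU_group] by auto
  fix W assume W: "openin T W"
  let ?V = "{A \<in> topspace T. inv\<^bsub>AU_group R L r\<^esub> A \<in> W}"
  show "openin T ?V"
  proof (subst openin_subopen, intro ballI)
    fix A assume A: "A \<in> ?V"
    then have "A \<in> AU" by simp
    then obtain C where C: "fin_convex C" "A \<in> U C" by (rule AU_cases)
    interpret incidence_cring R L "adj C" using C(1) by (rule adj_incidence_cring)
    have iW: "inv\<^bsub>K\<^esub> A \<in> W" using A AU_inv[OF C] by simp
    obtain F where F: "finite F" "F \<subseteq> L \<times> L"
      "\<And>X. X \<in> U C \<Longrightarrow> \<forall>x\<in>F. X x = (inv\<^bsub>K\<^esub> A) x \<Longrightarrow> X \<in> W"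
      using T_finite_dependence[OF W C(1) iW U_inv(1)[OF C]] by blast
    obtain G where G: "finite G" "G \<subseteq> L \<times> L"
      and dep: "\<And>A'. A' \<in> Units K \<Longrightarrow> \<forall>x\<in>G. A' x = A x \<Longrightarrow> \<forall>x\<in>F. (inv\<^bsub>K\<^esub> A') x = (inv\<^bsub>K\<^esub> A) x"
      using inverse_finite_dependence[OF _ F(1,2), of A] C unfolding U_eq_Units[OF C(1)] by blast
    have "inv\<^bsub>AU_group R L r\<^esub> B \<in> W" if B: "B \<in> U C" "\<forall>x\<in>G. B x = A x" for B
      unfolding AU_inv[OF C(1) B(1)]
      using B dep U_inv(1)[OF C(1) B(1)] by (intro F(3)) (auto simp: U_eq_Units[OF C(1)])
    then have "{B \<in> U C. \<forall>x\<in>G. B x = A x} \<subseteq> ?V" using U_subset_AU[OF C(1)] by auto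
    then show "\<exists>V. openin T V \<and> A \<in> V \<and> V \<subseteq> ?V"
      using neighbourhood_T[OF C G] C by (intro exI[of _ "{B \<in> U C. \<forall>x\<in>G. B x = A x}"]) auto
  qed
qed

lemma AU_topology_T: "AU_topology R L r T"
  unfolding AU_topology_def group_topology_def
proof (intro conjI allI impI)
  fix C assume C: "fin_convex C"
  have "{A \<in> U C. A \<in> W} = W \<inter> U C" for W by auto
  then show "continuous_map (U_topology R L (adj C)) T (\<lambda>A. A)"
    using C U_subset_AU[OF C] by (auto simp: continuous_map_def openin_T)
  show "open_map (U_topology R L (adj C)) T (\<lambda>A. A)"
    using openin_U_imp_openin_T[OF C] by (simp add: open_map_def)
qed (use AU_group continuous_mult_T continuous_inv_T in auto)

section \<open>Uniqueness and local profiniteness\<close>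

text \<open>Continuity of the inclusions makes \<open>T'\<close> coarser than \<open>T\<close>.
  Their openness makes it finer, because a \<open>T\<close>-open set is the union of its
  intersections with the groups \<open>U C\<close>.\<close>

lemma AU_topology_unique:
  assumes "AU_topology R L r T'"
  shows "T' = T"
  unfolding topology_eq
proof (intro allI iffI)
  fix W
  have top: "topspace T' = AU"
    and cont: "\<And>C. fin_convex C \<Longrightarrow> continuous_map (U_topology R L (adj C)) T' (\<lambda>A. A)"
    and op: "\<And>C. fin_convex C \<Longrightarrow> open_map (U_topology R L (adj C)) T' (\<lambda>A. A)"
    using assms by (auto simp: AU_topology_def group_topology_def)
  show "openin T W" if W: "openin T' W"
    unfolding openin_T
  proof (intro conjI allI impI)
    show "W \<subseteq> AU" using openin_subset[OF W] top by simp
    fix C assume "fin_convex C"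
    then have "openin (U_topology R L (adj C)) {A \<in> U C. A \<in> W}"
      using cont W by (simp add: continuous_map_def)
    moreover have "{A \<in> U C. A \<in> W} = W \<inter> U C" by auto
    ultimately show "openin (U_topology R L (adj C)) (W \<inter> U C)" by simp
  qed
  show "openin T' W" if W: "openin T W"
  proof -
    have "openin T' (W \<inter> U C)" if "fin_convex C" for C
      using op[OF that] W that by (simp add: open_map_def openin_T)
    then have "openin T' (\<Union>C\<in>Collect fin_convex. W \<inter> U C)" by (intro openin_Union) auto
    moreover have "(\<Union>C\<in>Collect fin_convex. W \<inter> U C) = W"
    proof (intro equalityI subsetI)
      fix A assume A: "A \<in> W"
      then have "A \<in> AU" using openin_subset[OF W] by auto
      then obtain C where "fin_convex C" "A \<in> U C" by (rule AU_cases)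
      then show "A \<in> (\<Union>C\<in>Collect fin_convex. W \<inter> U C)" using A by blast
    qed blast
    ultimately show ?thesis by simp
  qed
qed

text \<open>The predicate is arbitrary, so it can be replaced by its negation: conditions on a
  single entry define clopen sets, and these separate distinct matrices.\<close>

lemma openin_T_entry:
  assumes x: "x \<in> L \<times> L"
  shows "openin T {A \<in> AU. P (A x)}"
proof (subst openin_subopen, intro ballI)
  fix A assume A: "A \<in> {A \<in> AU. P (A x)}"
  then have "A \<in> AU" by simp
  then obtain C where C: "fin_convex C" "A \<in> U C" by (rule AU_cases)
  have "openin T {B \<in> U C. \<forall>y\<in>{x}. B y = A y}" using C x by (intro neighbourhood_T) auto
  then show "\<exists>V. openin T V \<and> A \<in> V \<and> V \<subseteq> {A \<in> AU. P (A x)}"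
    using A C U_subset_AU[OF C(1)] by (intro exI[of _ "{B \<in> U C. \<forall>y\<in>{x}. B y = A y}"]) auto
qed

lemma totally_disconnected_T: "totally_disconnected_space T"
  unfolding totally_disconnected_space_def
proof
  fix A assume A: "A \<in> topspace T"
  have "B = A" if "connected_component_of T A B" for B
  proof (rule ccontr)
    assume "B \<noteq> A"
    obtain S where S: "connectedin T S" "A \<in> S" "B \<in> S"
      using \<open>connected_component_of T A B\<close> by (auto simp: connected_component_of_def)
    then have SU: "S \<subseteq> AU" using connectedin_subset_topspace[OF S(1)] by simp
    then have "A \<in> extensional (L \<times> L)" "B \<in> extensional (L \<times> L)"
      using S by (auto simp: AU_set_def PiE_iff)
    then obtain x where x: "x \<in> L \<times> L" "B x \<noteq> A x"
      using \<open>B \<noteq> A\<close> extensionalityI by metis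
    have "openin T {X \<in> AU. X x = A x}" "openin T {X \<in> AU. X x \<noteq> A x}"
      using openin_T_entry[OF x(1), of "\<lambda>c. c = A x"] openin_T_entry[OF x(1), of "\<lambda>c. c \<noteq> A x"]
      by simp_all
    moreover have "S \<subseteq> {X \<in> AU. X x = A x} \<union> {X \<in> AU. X x \<noteq> A x}"
      "{X \<in> AU. X x = A x} \<inter> {X \<in> AU. X x \<noteq> A x} \<inter> S = {}"
      "{X \<in> AU. X x = A x} \<inter> S \<noteq> {}" "{X \<in> AU. X x \<noteq> A x} \<inter> S \<noteq> {}"
      using SU S x by auto
    ultimately show False using S(1) unfolding connectedin by blast
  qed
  moreover have "connected_component_of T A A" using A connected_component_of_refl by metis
  ultimately show "connected_component_of_set T A = {A}" by auto
qed

text \<open>\<open>U C\<close> serves both as the open set and as the compact set: Tychonoff's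
  theorem makes it compact in its own topology, and the inclusion carries this over to
  \<open>T\<close>.\<close>

lemma locally_compact_T:
  assumes "finite (carrier R)"
  shows "locally_compact_space T"
  unfolding locally_compact_space_def
proof
  fix A assume "A \<in> topspace T"
  then have "A \<in> AU" by simp
  then obtain C where C: "fin_convex C" "A \<in> U C" by (rule AU_cases)
  have "compact_space (mat_topology R L)"
    using assms by (simp add: mat_topology_def compact_space_product_topology compact_space_discrete_topology)
  then have "compactin (mat_topology R L) (U C)"
    using incidence_cring.closedin_U_set[OF adj_incidence_cring[OF C(1)]] by (rule closedin_compact_space)
  then have "compactin (U_topology R L (adj C)) (U C)"
    by (simp add: U_topology_def compactin_subtopology)
  moreover have "continuous_map (U_topology R L (adj C)) T (\<lambda>A. A)"
    using AU_topology_T C by (simp add: AU_topology_def)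
  ultimately have "compactin T ((\<lambda>A. A) ` U C)" by (rule image_compactin)
  then show "\<exists>V K. openin T V \<and> compactin T K \<and> A \<in> V \<and> V \<subseteq> K"
    using openin_T_U[OF C(1)] C by (intro exI[of _ "U C"]) auto
qed

end

theorem mainTheorem2:
  fixes R :: "('r, 'm) ring_scheme" and L :: "'i set" and r :: "('i \<times> 'i) set"
  assumes "cring R"
    and "preorder_on L r"
    and "Z_like L r"
  shows "(\<exists>!T. AU_topology R L r T) \<and>
         (finite (carrier R) \<longrightarrow>
            (\<forall>T. AU_topology R L r T \<longrightarrow> locally_profinite (AU_group R L r) T))"
proof -
  interpret Z_like_cring R L r
    using assms by (intro Z_like_cring.intro Z_like_cring_axioms.intro)
  \<comment> \<open>By uniqueness it suffices to treat the constructed topology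
    \<open>T\<close>.\<close>
  have "locally_profinite (AU_group R L r) T" if "finite (carrier R)"
    using AU_topology_T totally_disconnected_T locally_compact_T[OF that]
    by (simp add: locally_profinite_def AU_topology_def)
  then show ?thesis using AU_topology_T AU_topology_unique by blast
qed

end
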